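(* Let $t\ge 1$ be an integer. For any random matrix $\mathcal{P}$ with values in $\mathcal{G}_{\lambda,d}$ and all $X_1,\dots,X_t\in\mathscr{H}_d$, $$\mu_{\mathcal{P}}(X_1,\ldots,X_t) = \frac{1}{t!}\sum_{J\subset\{1,\ldots,t\} }(-1)^{t+\# J}\, \mu^t_{\mathcal{P}}\Big(\sum_{j\in J} X_j\Big).$$ In particular, if $\mathcal{P}$ is distributed according to $\sigma_{\lambda,d}$, then the right-hand side can be computed by $$\mu^t_{\lambda,d}(X) = \sum_{\pi\in\mathscr{P}_{t,d}}\frac{C_\pi(X)\,C_\pi(D_\lambda)}{C_\pi(I_d)},\qquad\text{for all } X\in\mathscr{H}_d.$$
   Context: $\mathscr{H}_d$ is the space of real symmetric $d\times d$ matrices with inner product $\langle X,Y\rangle=\operatorname{trace}(XY^* )$; $I_d$ is the identity matrix. $\lambda=(\lambda_1,\dots,\lambda_d)^*$ is a fixed vector with $1\ge\lambda_1\ge\dots\ge\lambda_k>\lambda_{k+1}=\dots=\lambda_d=0$ (with $1\le k<d$), $D_\lambda=\operatorname{diag}(\lambda_1,\dots,\lambda_d)$, and $\mathcal{G}_{\lambda,d}=\{OD_\lambda O^*:O\in\mathcal{O}(d)\}$, where $\mathcal{O}(d)$ is the orthogonal group. $\sigma_{\lambda,d}$ is the distribution of $OD_\lambda O^*$ with $O$ distributed according to normalized Haar measure on $\mathcal{O}(d)$. Trace moments: $\mu^t_{\mathcal{P}}(X)=\mathbb{E}(\langle\mathcal{P},X\rangle^t)$ and $\mu^t_{\lambda,d}(X)=\int_{\mathcal{G}_{\lambda,d}}\langle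 P,X\rangle^t\,d\sigma_{\lambda,d}(P)$. Cross-moments: $\mu_{\mathcal{P}}(X_1,\dots,X_t)=\mathbb{E}(\langle X_1,\mathcal{P}\rangle\cdots\langle X_t,\mathcal{P}\rangle)$. $\mathscr{P}_{t,d}$ is the set of partitions of $t$ with at most $d$ nonzero parts. For $\pi\in\mathscr{P}_{t,d}$, $C_\pi$ denotes the zonal polynomial on $\mathscr{H}_d$ in the standard normalization: $GL_d(\mathbb{R})$ acts on the homogeneous polynomials $p$ of degree $t$ on $\mathscr{H}_d$ by $(g\cdot p)(X)=p(g^{T}Xg)$; this representation decomposes without multiplicities as $\bigoplus_{\pi\in\mathscr{P}_{t,d}}V_\pi$, with $V_\pi$ irreducible of highest weight $2\pi=(2\pi_1,2\pi_2,\dots)$, and $C_\pi$ is the component in $V_\pi$ of the polynomial $X\mapsto \operatorname{trace}(X)^t$. (So $C_\pi$ is homogeneous of degree $t$, invariant under conjugation by $\mathcal{O}(d)$, and $\operatorname{trace}(X)^t=\sum_{\pi\in\mathscr{P}_{t,d}}C_\pi(X)$.) *)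

theory Defs
  imports "HOL-Probability.Probability"
begin

text \<open>
  Matrices have type \<open>real^'n^'n\<close>, so \<open>d = CARD('n)\<close>.  The linear order on the finite index
  type \<open>'n\<close> plays the role of the order of \<open>1, \<dots>, d\<close>.
\<close>

definition sym_mats :: "(real^'n^'n) set" where
  "sym_mats = {X. transpose X = X}"

definition trace_inner :: "real^'n^'n \<Rightarrow> real^'n^'n \<Rightarrow> real" where
  "trace_inner X Y = trace (X ** transpose Y)"

definition diag_mat :: "real^'n \<Rightarrow> real^'n^'n" where
  "diag_mat v = (\<chi> i j. if i = j then v $ i else 0)"

definition orbit_mats :: "real^'n \<Rightarrow> (real^'n^'n) set" where
  "orbit_mats lam = {Q ** diag_mat lam ** transpose Q | Q. orthogonal_matrix Q}"

definition trace_moment :: "'a measure \<Rightarrow> ('a \<Rightarrow> real^'n^'n) \<Rightarrow> nat \<Rightarrow> real^'n^'n \<Rightarrow> real" where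
  "trace_moment M P t X = (\<integral>\<omega>. trace_inner (P \<omega>) X ^ t \<partial>M)"

definition cross_moment ::
    "'a measure \<Rightarrow> ('a \<Rightarrow> real^'n^'n) \<Rightarrow> nat \<Rightarrow> (nat \<Rightarrow> real^'n^'n) \<Rightarrow> real" where
  "cross_moment M P t X = (\<integral>\<omega>. (\<Prod>j=1..t. trace_inner (X j) (P \<omega>)) \<partial>M)"

definition normalized_haar :: "(real^'n^'n) measure \<Rightarrow> bool" where
  "normalized_haar H \<longleftrightarrow>
     sets H = sets (restrict_space borel {Q. orthogonal_matrix Q}) \<and> prob_space H \<and>
     (\<forall>Q. orthogonal_matrix Q \<longrightarrow> distr H H (\<lambda>R. Q ** R) = H)"

text \<open>The orbit distribution is a measure on the Borel sets of the whole matrix space;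
  it is concentrated on \<open>orbit_mats lam\<close>.\<close>

definition orbit_distr :: "(real^'n^'n) measure \<Rightarrow> real^'n \<Rightarrow> (real^'n^'n) measure" where
  "orbit_distr H lam = distr H borel (\<lambda>Q. Q ** diag_mat lam ** transpose Q)"

definition orbit_moment :: "(real^'n^'n) measure \<Rightarrow> real^'n \<Rightarrow> nat \<Rightarrow> real^'n^'n \<Rightarrow> real" where
  "orbit_moment H lam t X = (\<integral>P. trace_inner P X ^ t \<partial>orbit_distr H lam)"

text \<open>Partitions of \<open>t\<close> with at most \<open>d\<close> nonzero parts, padded by zeros to length \<open>d\<close>.\<close>

definition partitions_upto :: "nat \<Rightarrow> ('n::{finite,linorder} \<Rightarrow> nat) set" where
  "partitions_upto t = {\<pi>. antimono \<pi> \<and> (\<Sum>i\<in>UNIV. \<pi> i) = t}"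

text \<open>
  Homogeneous polynomials of degree \<open>t\<close> on \<open>sym_mats\<close>, as functions.  To make equality of
  functions agree with equality on \<open>sym_mats\<close>, they are extended by \<open>0\<close> to all matrices.  The
  action of an invertible \<open>g\<close> respects this, since then \<open>g\<^sup>T X g\<close> is symmetric iff \<open>X\<close> is.
\<close>

definition sym_hom_polys :: "nat \<Rightarrow> (real^'n^'n \<Rightarrow> real) set" where
  "sym_hom_polys t = {p.
     (\<exists>q. real_polynomial_function q \<and> (\<forall>X\<in>sym_mats. p X = q X)) \<and>
     (\<forall>c. \<forall>X\<in>sym_mats. p (c *\<^sub>R X) = c ^ t * p X) \<and>
     (\<forall>X. X \<notin> sym_mats \<longrightarrow> p X = 0)}"

definition gl_act :: "real^'n^'n \<Rightarrow> (real^'n^'n \<Rightarrow> real) \<Rightarrow> real^'n^'n \<Rightarrow> real" where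
  "gl_act g p = (\<lambda>X. p (transpose g ** X ** g))"

definition subrep :: "nat \<Rightarrow> (real^'n^'n \<Rightarrow> real) set \<Rightarrow> bool" where
  "subrep t V \<longleftrightarrow> V \<subseteq> sym_hom_polys t \<and>
     (\<lambda>X. 0) \<in> V \<and>
     (\<forall>p\<in>V. \<forall>q\<in>V. (\<lambda>X. p X + q X) \<in> V) \<and>
     (\<forall>c. \<forall>p\<in>V. (\<lambda>X. c * p X) \<in> V) \<and>
     (\<forall>g. invertible g \<longrightarrow> (\<forall>p\<in>V. gl_act g p \<in> V))"

definition irreducible_subrep :: "nat \<Rightarrow> (real^'n^'n \<Rightarrow> real) set \<Rightarrow> bool" where
  "irreducible_subrep t V \<longleftrightarrow> subrep t V \<and> V \<noteq> {\<lambda>X. 0} \<and>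
     (\<forall>W. subrep t W \<and> W \<subseteq> V \<longrightarrow> W = {\<lambda>X. 0} \<or> W = V)"

text \<open>Highest weights are taken with respect to the Borel subgroup of upper triangular matrices.\<close>

definition has_highest_weight ::
    "(real^'n::{finite,linorder}^'n::_ \<Rightarrow> real) set \<Rightarrow> ('n \<Rightarrow> nat) \<Rightarrow> bool" where
  "has_highest_weight V \<alpha> \<longleftrightarrow> (\<exists>v\<in>V. v \<noteq> (\<lambda>X. 0) \<and>
     (\<forall>b. invertible b \<and> (\<forall>i j. j < i \<longrightarrow> b $ i $ j = 0) \<longrightarrow>
        gl_act b v = (\<lambda>X. (\<Prod>i\<in>UNIV. (b $ i $ i) ^ \<alpha> i) * v X)))"

definition zonal_space :: "('n \<Rightarrow> nat) \<Rightarrow> (real^'n::{finite,linorder}^'n::_ \<Rightarrow> real) set" where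
  "zonal_space \<pi> = (THE V. irreducible_subrep (\<Sum>i\<in>UNIV. \<pi> i) V \<and>
                            has_highest_weight V (\<lambda>i. 2 * \<pi> i))"

text \<open>\<open>zonal_poly \<pi>\<close> is the component in \<open>zonal_space \<pi>\<close> of the \<open>t\<close>-th power of the trace, where
  \<open>t\<close> is the size of \<open>\<pi>\<close>; existence and uniqueness of the components express that the
  polynomials of degree \<open>t\<close> are the direct sum of the spaces \<open>zonal_space \<rho>\<close>.\<close>

definition zonal_poly :: "('n \<Rightarrow> nat) \<Rightarrow> real^'n::{finite,linorder}^'n::_ \<Rightarrow> real" where
  "zonal_poly \<pi> = (THE c. \<exists>C. C \<pi> = c \<and>
     (\<forall>\<rho>\<in>partitions_upto (\<Sum>i\<in>UNIV. \<pi> i). C \<rho> \<in> zonal_space \<rho>) \<and>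
     (\<forall>X\<in>sym_mats. trace X ^ (\<Sum>i\<in>UNIV. \<pi> i) =
        (\<Sum>\<rho>\<in>partitions_upto (\<Sum>i\<in>UNIV. \<pi> i). C \<rho> X)))"

end

theory Submission
  imports Defs "HOL-Library.Function_Algebras"
begin

text \<open>
  Expanding a product of numbers by polarization, under the integral sign, gives the formula for the
  cross-moments (\<open>cross_moment_polarization\<close>); the matrices of an orbit are bounded, so all
  integrals exist.

  The expansion of the orbit moment rests on the decomposition of the polynomials of degree \<open>t\<close> on
  symmetric matrices under the general linear group.  The functions \<open>X \<mapsto> \<langle>Y, X\<rangle>\<^sup>t\<close> are positive
  semidefinite as a kernel in \<open>X\<close> and \<open>Y\<close>, so their span carries an inner product in which they
  represent point evaluations.  With respect to it the adjoint of a matrix is its transpose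
  (\<open>ip_gl_act\<close>), which makes orthogonal complements of subrepresentations invariant.

  For a partition \<open>\<pi>\<close>, a product of leading principal minors is a vector of highest weight \<open>2\<pi>\<close>.  It is
  unique up to a factor, because near the identity every symmetric matrix is \<open>b\<^sup>T b\<close> with \<open>b\<close> upper
  triangular (\<open>semi_invariant_unique\<close>).  By uniqueness and complements, the space that it
  generates is irreducible and is the only irreducible space of this highest weight
  (\<open>irreducible_constituent\<close>, \<open>zonal_space_eq\<close>).  Different partitions give orthogonal spaces, because
  near the identity every matrix is a product of a lower and an upper triangular one
  (\<open>ip_constituent_constituent\<close>).

  The projections of the trace power onto these spaces are nonzero, orthogonal and invariant under
  conjugation by orthogonal matrices.  An invariant function is determined by its values on
  diagonal matrices (\<open>diagonalize\<close>), where a polynomial of degree \<open>t\<close> is a combination of symmetric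
  monomials, one for each partition.  Comparing dimensions, the projections span all invariants
  (\<open>conj_invariant_in_span\<close>).  In particular the trace power is their sum, which identifies them as the zonal
  polynomials (\<open>zonal_poly_eq\<close>).

  The orbit moment is invariant as a function of its argument, so it is a combination of zonal polynomials.
  Its inner product with \<open>C\<^sub>\<pi>\<close> can be taken under the integral and gives the mean of \<open>C\<^sub>\<pi>\<close> over the
  orbit, which is \<open>C\<^sub>\<pi>\<close> at the diagonal matrix; the inner product of \<open>C\<^sub>\<pi>\<close> with itself is its value at the
  identity.  The quotient is the coefficient (\<open>orbit_moment_expansion\<close>).
\<close>

section \<open>Reproducing kernels on spaces of functions\<close>

definition fscale :: "real \<Rightarrow> ('x \<Rightarrow> real) \<Rightarrow> 'x \<Rightarrow> real" where
  "fscale c f = (\<lambda>x. c * f x)"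

lemma fscale_apply: "fscale c f x = c * f x"
  by (simp add: fscale_def)

interpretation fs: vector_space fscale
  by standard (auto simp: fun_eq_iff fscale_apply algebra_simps)

lemma sum_fun_apply: "(\<Sum>i\<in>I. f i) x = (\<Sum>i\<in>I. (f i x :: real))"
  by (induction I rule: infinite_finite_induct) auto

text \<open>
  Kept out of the simpset, where these equations would also rewrite unapplied functions.
\<close>

declare plus_fun_apply [simp del] zero_fun_apply [simp del] minus_apply [simp del]
  uminus_apply [simp del]

lemmas fun_applies = plus_fun_apply zero_fun_apply fscale_apply sum_fun_apply minus_apply uminus_apply

lemma span_image_explicit:
  assumes "f \<in> fs.span (K ` S)"
  shows "\<exists>F c. finite F \<and> F \<subseteq> S \<and> f = (\<Sum>y\<in>F. fscale (c y) (K y))"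
proof -
  obtain T r where T: "finite T" "T \<subseteq> K ` S" "f = (\<Sum>g\<in>T. fscale (r g) g)"
    using assms unfolding fs.span_explicit by blast
  obtain F where F: "F \<subseteq> S" "inj_on K F" "T = K ` F"
    using T(2) subset_image_inj[of T K S] by blast
  have "finite F"
    using F T(1) finite_imageD by blast
  moreover have "f = (\<Sum>y\<in>F. fscale (r (K y)) (K y))"
    using T(3) F by (simp add: sum.reindex)
  ultimately show ?thesis
    using F(1) by (intro exI[of _ F] exI[of _ "\<lambda>y. r (K y)"]) simp
qed

text \<open>
  An independent family that is as large as a spanning set spans, since otherwise it could be
  enlarged beyond the size of that spanning set.
\<close>

lemma span_eq_of_card_le:
  assumes "finite B" "fs.independent A" "A \<subseteq> fs.span B" "card B \<le> card A"
  shows "fs.span B \<subseteq> fs.span A"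
proof
  fix f assume f: "f \<in> fs.span B"
  show "f \<in> fs.span A"
  proof (rule ccontr)
    assume n: "f \<notin> fs.span A"
    then have i: "fs.independent (insert f A)"
      using assms(2) by (rule fs.independent_insertI)
    have "f \<notin> A" using n fs.span_base by blast
    have fin: "finite A" "card (insert f A) \<le> card B"
      using fs.independent_span_bound[OF assms(1) assms(2,3)]
        fs.independent_span_bound[OF assms(1) i] assms(3) f by auto
    then show False using \<open>f \<notin> A\<close> assms(4) by simp
  qed
qed

text \<open>
  A positive semidefinite kernel \<open>k\<close> on \<open>S\<close> makes the span of the functions \<open>k y\<close> an inner
  product space in which \<open>k y\<close> represents the evaluation at \<open>y\<close>.
\<close>

locale kernel_space =
  fixes S :: "'x set" and k :: "'x \<Rightarrow> 'x \<Rightarrow> real" and D :: "('x \<Rightarrow> real) set"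
  assumes k_commute: "\<And>x y. x \<in> S \<Longrightarrow> y \<in> S \<Longrightarrow> k x y = k y x"
    and k_psd: "\<And>F c. finite F \<Longrightarrow> F \<subseteq> S \<Longrightarrow> 0 \<le> (\<Sum>x\<in>F. \<Sum>y\<in>F. c x * c y * k x y)"
    and k_off: "\<And>x y. x \<notin> S \<Longrightarrow> k y x = 0"
    and finite_D: "finite D"
    and k_D: "k ` S \<subseteq> fs.span D"
begin

definition V :: "('x \<Rightarrow> real) set" where
  "V = fs.span (k ` S)"

definition rep :: "('x \<Rightarrow> real) \<Rightarrow> 'x set \<times> ('x \<Rightarrow> real)" where
  "rep f = (SOME (F, c). finite F \<and> F \<subseteq> S \<and> f = (\<Sum>y\<in>F. fscale (c y) (k y)))"

text \<open>
  On \<open>V\<close> this does not depend on the chosen representation of \<open>f\<close>, because it is also the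
  pairing of a representation of \<open>g\<close> with the values of \<open>f\<close>.
\<close>

definition ip :: "('x \<Rightarrow> real) \<Rightarrow> ('x \<Rightarrow> real) \<Rightarrow> real" where
  "ip f g = (\<Sum>y\<in>fst (rep f). snd (rep f) y * g y)"

lemma subspace_V: "fs.subspace V"
  unfolding V_def by (rule fs.subspace_span)

lemma k_in_V: "y \<in> S \<Longrightarrow> k y \<in> V"
  unfolding V_def by (simp add: fs.span_base)

lemma V_off: "f \<in> V \<Longrightarrow> x \<notin> S \<Longrightarrow> f x = 0"
  using span_image_explicit[of f k S] unfolding V_def by (auto simp: k_off fun_applies)

lemma rep:
  assumes "f \<in> V"
  shows "finite (fst (rep f))" "fst (rep f) \<subseteq> S"
    "f = (\<Sum>y\<in>fst (rep f). fscale (snd (rep f) y) (k y))"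
proof -
  have "\<exists>p. case p of (F, c) \<Rightarrow> finite F \<and> F \<subseteq> S \<and> f = (\<Sum>y\<in>F. fscale (c y) (k y))"
    using span_image_explicit[of f k S] assms unfolding V_def by auto
  from someI_ex[OF this] have "case rep f of (F, c) \<Rightarrow>
      finite F \<and> F \<subseteq> S \<and> f = (\<Sum>y\<in>F. fscale (c y) (k y))"
    unfolding rep_def .
  then show "finite (fst (rep f))" "fst (rep f) \<subseteq> S"
    "f = (\<Sum>y\<in>fst (rep f). fscale (snd (rep f) y) (k y))"
    by (auto split: prod.splits)
qed

lemma ip_commute:
  assumes "f \<in> V" "g \<in> V"
  shows "ip f g = ip g f"
proof -
  let ?F = "fst (rep f)" and ?c = "snd (rep f)" and ?G = "fst (rep g)" and ?d = "snd (rep g)"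
  have "ip f g = (\<Sum>x\<in>?F. ?c x * (\<Sum>y\<in>?G. fscale (?d y) (k y)) x)"
    unfolding ip_def rep(3)[OF assms(2), symmetric] ..
  also have "\<dots> = (\<Sum>x\<in>?F. \<Sum>y\<in>?G. ?c x * (?d y * k y x))"
    by (simp add: fun_applies sum_distrib_left)
  also have "\<dots> = (\<Sum>y\<in>?G. \<Sum>x\<in>?F. ?d y * (?c x * k x y))"
    using rep(2)[OF assms(1)] rep(2)[OF assms(2)]
    by (subst sum.swap) (intro sum.cong refl, auto simp: k_commute subset_iff)
  also have "\<dots> = (\<Sum>y\<in>?G. ?d y * (\<Sum>x\<in>?F. fscale (?c x) (k x)) y)"
    by (simp add: fun_applies sum_distrib_left)
  also have "\<dots> = ip g f"
    unfolding ip_def rep(3)[OF assms(1), symmetric] ..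
  finally show ?thesis .
qed

lemma ip_add_right: "ip f (g + h) = ip f g + ip f h"
  by (simp add: ip_def fun_applies algebra_simps sum.distrib)

lemma ip_diff_right: "ip f (g - h) = ip f g - ip f h"
  by (simp add: ip_def fun_applies algebra_simps sum_subtractf)

lemma ip_scale_right: "ip f (fscale c g) = c * ip f g"
  by (simp add: ip_def fscale_apply algebra_simps sum_distrib_left)

lemma ip_zero_right [simp]: "ip f 0 = 0"
  by (simp add: ip_def fun_applies)

lemma ip_sum_right: "ip f (\<Sum>i\<in>I. g i) = (\<Sum>i\<in>I. ip f (g i))"
  by (induction I rule: infinite_finite_induct) (auto simp: ip_add_right)

lemma ip_diff_left:
  assumes "f \<in> V" "g \<in> V" "h \<in> V"
  shows "ip (f - g) h = ip f h - ip g h"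
  using assms by (metis ip_commute ip_diff_right fs.subspace_diff subspace_V)

lemma ip_add_left:
  assumes "f \<in> V" "g \<in> V" "h \<in> V"
  shows "ip (f + g) h = ip f h + ip g h"
  using assms by (metis ip_commute ip_add_right fs.subspace_add subspace_V)

lemma ip_scale_left:
  assumes "f \<in> V" "h \<in> V"
  shows "ip (fscale c f) h = c * ip f h"
  using assms by (metis ip_commute ip_scale_right fs.subspace_scale subspace_V)

lemma ip_sum_left:
  assumes "\<And>i. i \<in> I \<Longrightarrow> f i \<in> V" "h \<in> V"
  shows "ip (\<Sum>i\<in>I. f i) h = (\<Sum>i\<in>I. ip (f i) h)"
  using assms(1)
  by (subst ip_commute)
    (auto simp: ip_sum_right assms(2) intro!: fs.subspace_sum subspace_V sum.cong ip_commute)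

lemma ip_kernel:
  assumes "y \<in> S" "f \<in> V"
  shows "ip (k y) f = f y"
proof -
  have "ip (k y) f = ip f (k y)"
    using assms by (simp add: ip_commute k_in_V)
  also have "\<dots> = (\<Sum>x\<in>fst (rep f). snd (rep f) x * k x y)"
    using rep(2)[OF assms(2)] assms(1)
    unfolding ip_def by (intro sum.cong refl) (auto simp: k_commute subset_iff)
  also have "\<dots> = (\<Sum>x\<in>fst (rep f). fscale (snd (rep f) x) (k x)) y"
    by (simp add: fun_applies)
  also have "\<dots> = f y"
    unfolding rep(3)[OF assms(2), symmetric] ..
  finally show ?thesis .
qed

lemma ip_nonneg:
  assumes "f \<in> V"
  shows "0 \<le> ip f f"
proof -
  let ?F = "fst (rep f)" and ?c = "snd (rep f)"
  have "ip f f = (\<Sum>x\<in>?F. ?c x * (\<Sum>y\<in>?F. fscale (?c y) (k y)) x)"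
    unfolding ip_def rep(3)[OF assms, symmetric] ..
  also have "\<dots> = (\<Sum>x\<in>?F. \<Sum>y\<in>?F. ?c x * (?c y * k y x))"
    by (simp add: fun_applies sum_distrib_left)
  also have "\<dots> = (\<Sum>x\<in>?F. \<Sum>y\<in>?F. ?c x * ?c y * k x y)"
    using rep(2)[OF assms] by (intro sum.cong refl) (auto simp: k_commute subset_iff)
  finally show ?thesis
    using k_psd[OF rep(1,2)[OF assms]] by simp
qed

text \<open>
  Definiteness: a vector of length \<open>0\<close> is orthogonal to everything by the Cauchy--Schwarz
  argument, in particular to the kernel functions, so all its values vanish.
\<close>

lemma ip_eq_0:
  assumes "f \<in> V" "ip f f = 0"
  shows "f = 0"
proof
  fix y show "f y = 0 y"
  proof (cases "y \<in> S")
    case True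
    define a where "a = ip (k y) (k y)"
    have V: "k y \<in> V" by (rule k_in_V[OF True])
    \<comment> \<open>the quadratic polynomial \<open>s \<mapsto> \<parallel>k y - s f\<parallel>\<^sup>2\<close> is affine with slope \<open>- 2 f y\<close>\<close>
    have pos: "0 \<le> a - 2 * s * f y" for s
    proof -
      have sV: "fscale s f \<in> V"
        using assms(1) subspace_V fs.subspace_scale by blast
      then have dV: "k y - fscale s f \<in> V"
        using V subspace_V fs.subspace_diff by blast
      have "ip (k y - fscale s f) (k y - fscale s f) = a - 2 * s * f y"
        using V sV dV assms ip_kernel[OF True assms(1)] ip_commute[OF V assms(1)]
        by (simp add: ip_diff_left ip_diff_right ip_scale_left ip_scale_right a_def)
      then show ?thesis using ip_nonneg[OF dV] by simp
    qed
    show ?thesis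
    proof (rule ccontr)
      assume "f y \<noteq> 0 y"
      then show False using pos[of "(a + 1) / (2 * f y)"] by (simp add: fun_applies field_simps)
    qed
  qed (use V_off assms in \<open>auto simp: fun_applies\<close>)
qed

text \<open>
  Gram--Schmidt: a new generator is first made orthogonal to the span of the earlier ones, and then
  the projection onto the resulting line is added.
\<close>

lemma orth_projection_finite:
  assumes "finite B" "B \<subseteq> V" "f \<in> V"
  shows "\<exists>p\<in>fs.span B. \<forall>u\<in>fs.span B. ip (f - p) u = 0"
  using assms
proof (induction B arbitrary: f rule: finite_induct)
  case empty
  then show ?case by (auto simp: fs.span_zero)
next
  case (insert b B)
  have sp: "fs.span B \<subseteq> V"
    by (rule fs.span_minimal) (use insert.prems subspace_V in auto)
  obtain q where q: "q \<in> fs.span B" "\<And>u. u \<in> fs.span B \<Longrightarrow> ip (b - q) u = 0"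
    using insert.IH[of b] insert.prems by auto
  obtain p where p: "p \<in> fs.span B" "\<And>u. u \<in> fs.span B \<Longrightarrow> ip (f - p) u = 0"
    using insert.IH[of f] insert.prems by auto
  define e where "e = b - q"
  define r where "r = p + fscale (ip f e / ip e e) e"
  have V: "b \<in> V" "q \<in> V" "p \<in> V" "f \<in> V"
    using insert.prems sp q p by auto
  have eV: "e \<in> V" unfolding e_def using V subspace_V fs.subspace_diff by blast
  have rV: "r \<in> V" unfolding r_def
    using V eV subspace_V fs.subspace_add fs.subspace_scale by blast
  have sub: "fs.span B \<subseteq> fs.span (insert b B)" by (rule fs.span_mono) auto
  have "e \<in> fs.span (insert b B)"
    unfolding e_def using q(1) sub by (intro fs.span_diff) (auto intro: fs.span_base)
  then have r: "r \<in> fs.span (insert b B)"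
    unfolding r_def using p(1) sub by (intro fs.span_add fs.span_scale) auto
  have e_orth: "ip e u = 0" if "u \<in> fs.span B" for u
    using q(2)[OF that] by (simp add: e_def)
  have e0: "ip (f - r) e = 0"
  proof (cases "ip e e = 0")
    case True
    then show ?thesis using ip_eq_0[OF eV] by simp
  next
    case False
    have "ip p e = 0" using ip_commute[OF V(3) eV] e_orth[OF p(1)] by simp
    moreover have "ip r e = ip p e + ip f e"
      unfolding r_def using V eV False fs.subspace_scale[OF subspace_V eV]
      by (simp add: ip_add_left ip_scale_left)
    ultimately show ?thesis using V eV rV by (simp add: ip_diff_left)
  qed
  have B0: "ip (f - r) u = 0" if u: "u \<in> fs.span B" for u
  proof -
    have uV: "u \<in> V" using u sp by auto
    have eq: "f - r = (f - p) - fscale (ip f e / ip e e) e"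
      by (simp add: r_def fun_eq_iff fun_applies)
    have "f - p \<in> V" using V subspace_V fs.subspace_diff by blast
    then show ?thesis
      unfolding eq using p(2)[OF u] e_orth[OF u] eV uV fs.subspace_scale[OF subspace_V eV]
      by (simp only: ip_diff_left ip_scale_left)
  qed
  have "ip (f - r) u = 0" if u: "u \<in> fs.span (insert b B)" for u
  proof -
    obtain c where c: "u - fscale c b \<in> fs.span B"
      using u unfolding fs.span_insert by blast
    have "u = (u - fscale c b + fscale c q) + fscale c e"
      by (simp add: e_def fun_eq_iff fun_applies algebra_simps)
    moreover have "u - fscale c b + fscale c q \<in> fs.span B"
      using c q(1) by (intro fs.span_add fs.span_scale)
    ultimately show ?thesis
      using B0 e0 by (metis ip_add_right ip_scale_right add_0 mult_zero_right)
  qed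
  then show ?case using r by blast
qed

text \<open>
  All functions in \<open>V\<close> are combinations of the finitely many functions in \<open>D\<close>, so every subspace
  has a finite basis and with it an orthogonal projection.
\<close>

lemma orth_projection:
  assumes "fs.subspace W" "W \<subseteq> V" "f \<in> V"
  shows "\<exists>p\<in>W. \<forall>u\<in>W. ip (f - p) u = 0"
proof -
  obtain B where B: "B \<subseteq> W" "fs.independent B" "W \<subseteq> fs.span B"
    using fs.maximal_independent_subset by blast
  have "V \<subseteq> fs.span D"
    unfolding V_def by (rule fs.span_minimal[OF k_D fs.subspace_span])
  then have "finite B"
    using fs.independent_span_bound[OF finite_D B(2)] B(1) assms(2) by blast
  moreover have "fs.span B = W"
    using B assms(1) fs.span_minimal by blast
  ultimately show ?thesis
    using orth_projection_finite[of B f] B(1) assms(2,3) by auto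
qed

end

section \<open>Polarization\<close>

lemma trace_inner_eq_inner: "trace_inner X Y = X \<bullet> Y"
  by (simp add: trace_inner_def trace_def matrix_matrix_mult_def transpose_def inner_vec_def)

text \<open>
  The \<open>n\<close>-th power is differenced once for every element of \<open>A\<close>.  Each difference lowers the
  degree in \<open>y\<close> by one, so the result is \<open>0\<close> for \<open>n < card A\<close> and constant for \<open>n = card A\<close>.
\<close>

lemma iterated_difference_power:
  fixes x :: "'i \<Rightarrow> real"
  assumes "finite A"
  defines "d \<equiv> \<lambda>A n y. \<Sum>J\<in>Pow A. (-1) ^ (card A + card J) * (y + (\<Sum>j\<in>J. x j)) ^ n"
  shows "n \<le> card A \<Longrightarrow> d A n y = (if n = card A then fact n * (\<Prod>j\<in>A. x j) else 0)"
  using assms(1)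
proof (induction A arbitrary: n y rule: finite_induct)
  case empty
  then show ?case by (simp add: d_def)
next
  case (insert a A)
  have split: "d (insert a A) n y = d A n (y + x a) - d A n y"
  proof -
    have dis: "Pow A \<inter> insert a ` Pow A = {}" using insert.hyps by auto
    have inj: "inj_on (insert a) (Pow A)" using insert.hyps by (auto simp: inj_on_def)
    have J: "finite J" "a \<notin> J" if "J \<in> Pow A" for J
      using that insert.hyps finite_subset by auto
    have "d (insert a A) n y =
        (\<Sum>J\<in>Pow A. (-1) ^ (Suc (card A) + card J) * (y + (\<Sum>j\<in>J. x j)) ^ n) +
        (\<Sum>J\<in>Pow A. (-1) ^ (Suc (card A) + card (insert a J)) *
            (y + (\<Sum>j\<in>insert a J. x j)) ^ n)"
      using insert.hyps unfolding d_def Pow_insert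
      by (subst sum.union_disjoint) (auto simp: dis sum.reindex[OF inj])
    also have "\<dots> = - d A n y + d A n (y + x a)"
      unfolding d_def using J
      by (intro arg_cong2[where f = "(+)"])
        (auto simp: sum_negf[symmetric] add.assoc intro!: sum.cong)
    finally show ?thesis by simp
  qed
  have deriv: "DERIV (\<lambda>y. d A n y) y :> real n * d A (n - 1) y" for y
    unfolding d_def
    by (auto intro!: derivative_eq_intros sum.cong simp: sum_distrib_left algebra_simps)
  define c where "c = (if n - 1 = card A then fact (n - 1) * (\<Prod>j\<in>A. x j) else 0)"
  have "n - 1 \<le> card A" using insert.prems insert.hyps by simp
  then have "d A (n - 1) y = c" for y
    using insert.IH[of "n - 1"] by (simp add: c_def)
  then have D: "DERIV (\<lambda>y. d A n y) y :> real n * c" for y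
    using deriv by metis
  have "d A n (y + x a) - d A n y = x a * (real n * c)"
  proof (cases "x a = 0")
    case False
    then show ?thesis
      using DERIV_const_ratio_const[of y "y + x a" "\<lambda>y. d A n y" "real n * c"] D by simp
  qed simp
  then show ?case
    using insert.hyps unfolding split c_def by (cases n) (auto simp: algebra_simps)
qed

lemma polarization:
  fixes x :: "'i \<Rightarrow> real"
  assumes "finite A"
  shows "(\<Prod>j\<in>A. x j) =
    1 / fact (card A) *
      (\<Sum>J\<in>Pow A. (-1) ^ (card A + card J) * (\<Sum>j\<in>J. x j) ^ card A)"
  using iterated_difference_power[OF assms, where n = "card A" and x = x and y = 0] by simp

section \<open>Powers of linear forms on symmetric matrices\<close>

text \<open>
  The powers of the inner product are positive semidefinite: expanding one factor in coordinates
  writes the form of degree \<open>t + 1\<close> as a sum of forms of degree \<open>t\<close> with coefficients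
  \<open>c x * (x \<bullet> b)\<close>.
\<close>

lemma psd_inner_power:
  fixes c :: "'v::euclidean_space \<Rightarrow> real"
  assumes "finite F"
  shows "0 \<le> (\<Sum>x\<in>F. \<Sum>y\<in>F. c x * c y * (x \<bullet> y) ^ t)"
proof (induction t arbitrary: c)
  case 0
  have "(\<Sum>x\<in>F. \<Sum>y\<in>F. c x * c y * (x \<bullet> y) ^ 0) = (\<Sum>x\<in>F. c x)\<^sup>2"
    by (simp add: power2_eq_square sum_product)
  then show ?case by simp
next
  case (Suc t)
  have "(\<Sum>x\<in>F. \<Sum>y\<in>F. c x * c y * (x \<bullet> y) ^ Suc t) =
      (\<Sum>x\<in>F. \<Sum>y\<in>F. \<Sum>b\<in>Basis. (c x * (x \<bullet> b)) * (c y * (y \<bullet> b)) * (x \<bullet> y) ^ t)"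
    by (intro sum.cong refl)
      (subst power_Suc, subst euclidean_inner, simp add: sum_distrib_left sum_distrib_right mult_ac)
  also have "\<dots> = (\<Sum>x\<in>F. \<Sum>b\<in>Basis. \<Sum>y\<in>F.
      (c x * (x \<bullet> b)) * (c y * (y \<bullet> b)) * (x \<bullet> y) ^ t)"
    by (intro sum.cong refl sum.swap)
  also have "\<dots> = (\<Sum>b\<in>Basis. \<Sum>x\<in>F. \<Sum>y\<in>F.
      (c x * (x \<bullet> b)) * (c y * (y \<bullet> b)) * (x \<bullet> y) ^ t)"
    by (rule sum.swap)
  also have "\<dots> \<ge> 0"
    by (intro sum_nonneg Suc.IH)
  finally show ?case .
qed

text \<open>
  The powers of linear forms, extended by \<open>0\<close> as the elements of \<^const>\<open>sym_hom_polys\<close> are.  They are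
  the functions from which the representation is built, because a change of variables by \<open>g\<close> turns
  the form of \<open>Y\<close> into the form of \<open>g Y g\<^sup>T\<close>.
\<close>

definition pow_kernel :: "nat \<Rightarrow> real^'n^'n \<Rightarrow> real^'n^'n \<Rightarrow> real" where
  "pow_kernel t Y = (\<lambda>X. if X \<in> sym_mats then (Y \<bullet> X) ^ t else 0)"

text \<open>
  Products of \<open>t\<close> coordinate functions.  They only serve to show that the span of the \<open>t\<close>-th powers
  of linear forms has finite dimension.
\<close>

primrec monomials :: "nat \<Rightarrow> (real^'n^'n \<Rightarrow> real) set" where
  "monomials 0 = {\<lambda>X. if X \<in> sym_mats then 1 else 0}"
| "monomials (Suc t) = (\<lambda>(B, m) X. (B \<bullet> X) * m X) ` (Basis \<times> monomials t)"

lemma pow_kernel_in_span_monomials: "pow_kernel t Y \<in> fs.span (monomials t)"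
proof (induction t)
  case 0
  then show ?case by (simp add: pow_kernel_def fs.span_base cong: if_cong)
next
  case (Suc t)
  have step: "(\<lambda>X. (B \<bullet> X) * f X) \<in> fs.span (monomials (Suc t))"
    if "B \<in> Basis" "f \<in> fs.span (monomials t)" for B f
    using that(2)
  proof (induction rule: fs.span_induct_alt)
    case base
    show ?case
      using fs.span_zero by (simp add: zero_fun_apply zero_fun_def)
  next
    case (step c m f)
    have eq: "(\<lambda>X. (B \<bullet> X) * (fscale c m + f) X) =
        fscale c (\<lambda>X. (B \<bullet> X) * m X) + (\<lambda>X. (B \<bullet> X) * f X)"
      by (simp add: fun_eq_iff fun_applies algebra_simps)
    have "(\<lambda>X. (B \<bullet> X) * m X) \<in> monomials (Suc t)"
      using step.hyps that(1) by (auto intro!: image_eqI[of _ _ "(B, m)"])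
    then show ?case
      unfolding eq by (intro fs.span_add fs.span_scale fs.span_base step.IH)
  qed
  have "(Y \<bullet> X) ^ Suc t = (\<Sum>B\<in>Basis. (Y \<bullet> B) * ((B \<bullet> X) * (Y \<bullet> X) ^ t))" for X
  proof -
    have "(Y \<bullet> X) ^ Suc t = (\<Sum>B\<in>Basis. (Y \<bullet> B) * (X \<bullet> B)) * (Y \<bullet> X) ^ t"
      unfolding power_Suc by (subst euclidean_inner) (rule refl)
    then show ?thesis
      by (simp add: sum_distrib_right inner_commute mult.assoc)
  qed
  then have eq: "pow_kernel (Suc t) Y =
      (\<Sum>B\<in>Basis. fscale (Y \<bullet> B) (\<lambda>X. (B \<bullet> X) * pow_kernel t Y X))"
    unfolding pow_kernel_def fun_eq_iff fun_applies by simp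
  show ?case
    unfolding eq by (intro fs.span_sum fs.span_scale step Suc)
qed

lemma finite_monomials: "finite (monomials t)"
  by (induction t) auto

interpretation tk: kernel_space sym_mats "pow_kernel t" "monomials t" for t
proof
  show "0 \<le> (\<Sum>x\<in>F. \<Sum>y\<in>F. c x * c y * pow_kernel t x y)"
    if "finite F" "F \<subseteq> sym_mats" for F and c :: "real^'n^'n \<Rightarrow> real"
  proof -
    have "(\<Sum>x\<in>F. \<Sum>y\<in>F. c x * c y * pow_kernel t x y) =
        (\<Sum>x\<in>F. \<Sum>y\<in>F. c x * c y * (x \<bullet> y) ^ t)"
      using that by (intro sum.cong refl) (auto simp: pow_kernel_def)
    then show ?thesis using psd_inner_power[OF that(1)] by simp
  qed
  show "pow_kernel t x y = pow_kernel t y x"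
    if "x \<in> sym_mats" "y \<in> sym_mats" for x y :: "real^'n^'n"
    using that by (simp add: pow_kernel_def inner_commute)
  show "pow_kernel t y x = 0" if "x \<notin> sym_mats" for x y :: "real^'n^'n"
    using that by (simp add: pow_kernel_def)
  show "finite (monomials t)" by (rule finite_monomials)
  show "pow_kernel t ` sym_mats \<subseteq> fs.span (monomials t)"
    using pow_kernel_in_span_monomials by blast
qed

abbreviation hom_polys :: "nat \<Rightarrow> (real^'n^'n \<Rightarrow> real) set" where
  "hom_polys t \<equiv> tk.V t"

lemma sym_mats_sum: "(\<And>j. j \<in> J \<Longrightarrow> X j \<in> sym_mats) \<Longrightarrow> (\<Sum>j\<in>J. X j) \<in> sym_mats"
  by (simp add: sym_mats_def transpose_def vec_eq_iff)

text \<open>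
  Polarization writes a product of linear forms as a combination of powers of linear forms.
\<close>

lemma prod_linear_in_hom_polys:
  assumes "finite A" "\<And>j. j \<in> A \<Longrightarrow> Y j \<in> sym_mats"
  shows "(\<lambda>X. if X \<in> sym_mats then \<Prod>j\<in>A. Y j \<bullet> X else 0) \<in> hom_polys (card A)"
proof -
  have "(\<lambda>X. if X \<in> sym_mats then \<Prod>j\<in>A. Y j \<bullet> X else 0) =
      fscale (1 / fact (card A)) (\<Sum>J\<in>Pow A. fscale ((-1) ^ (card A + card J))
        (pow_kernel (card A) (\<Sum>j\<in>J. Y j)))"
    unfolding fun_eq_iff
    by (auto simp: fun_applies pow_kernel_def polarization[OF assms(1)] inner_sum_left)
  moreover have "(\<Sum>j\<in>J. Y j) \<in> sym_mats" if "J \<in> Pow A" for J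
    using that assms(2) by (intro sym_mats_sum) auto
  ultimately show ?thesis
    by (simp only:) (intro fs.subspace_scale fs.subspace_sum tk.subspace_V tk.k_in_V)
qed

text \<open>
  A product of two powers of linear forms is again a product of linear forms.
\<close>

lemma hom_polys_mult:
  assumes "f \<in> hom_polys s" "g \<in> hom_polys t"
  shows "(\<lambda>X. f X * g X) \<in> hom_polys (s + t)"
proof -
  have K: "(\<lambda>X. pow_kernel s Y X * pow_kernel t Z X) \<in> hom_polys (s + t)"
    if "Y \<in> sym_mats" "Z \<in> sym_mats" for Y Z :: "real^'n^'n"
  proof -
    have "(\<Prod>j<s + t. (if j < s then Y else Z) \<bullet> X) = (Y \<bullet> X) ^ s * (Z \<bullet> X) ^ t" for X
      by (induction t) (auto simp: mult_ac)
    then have eq: "(\<lambda>X. pow_kernel s Y X * pow_kernel t Z X) =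
        (\<lambda>X. if X \<in> sym_mats then \<Prod>j<s + t. (if j < s then Y else Z) \<bullet> X else 0)"
      by (auto simp: pow_kernel_def fun_eq_iff)
    show ?thesis
      unfolding eq
      using prod_linear_in_hom_polys[of "{..<s + t}" "\<lambda>j. if j < s then Y else Z"] that by simp
  qed
  have K2: "(\<lambda>X. pow_kernel s Y X * g X) \<in> hom_polys (s + t)" if "Y \<in> sym_mats" for Y
  proof -
    have "g \<in> fs.span (pow_kernel t ` sym_mats)"
      using assms(2) by (simp only: tk.V_def)
    then show ?thesis
    proof (induction rule: fs.span_induct_alt)
      case base
      show ?case using fs.subspace_0[OF tk.subspace_V[of "s + t"]]
        by (simp add: zero_fun_apply zero_fun_def)
    next
      case (step c k f)
      have eq: "(\<lambda>X. pow_kernel s Y X * (fscale c k + f) X) =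
          fscale c (\<lambda>X. pow_kernel s Y X * k X) + (\<lambda>X. pow_kernel s Y X * f X)"
        by (simp add: fun_eq_iff fun_applies algebra_simps)
      have "(\<lambda>X. pow_kernel s Y X * k X) \<in> hom_polys (s + t)"
        using step.hyps K[OF that] by auto
      then show ?case
        unfolding eq using step.IH
        by (intro fs.subspace_add fs.subspace_scale tk.subspace_V)
    qed
  qed
  have "f \<in> fs.span (pow_kernel s ` sym_mats)"
    using assms(1) by (simp only: tk.V_def)
  then show ?thesis
  proof (induction rule: fs.span_induct_alt)
    case base
    show ?case using fs.subspace_0[OF tk.subspace_V[of "s + t"]]
      by (simp add: zero_fun_apply zero_fun_def)
  next
    case (step c k f)
    have eq: "(\<lambda>X. (fscale c k + f) X * g X) =
        fscale c (\<lambda>X. k X * g X) + (\<lambda>X. f X * g X)"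
      by (simp add: fun_eq_iff fun_applies algebra_simps)
    have "(\<lambda>X. k X * g X) \<in> hom_polys (s + t)"
      using step.hyps K2 by auto
    then show ?case
      unfolding eq using step.IH
      by (intro fs.subspace_add fs.subspace_scale tk.subspace_V)
  qed
qed

lemma hom_polys_prod:
  assumes "finite I" "\<And>i. i \<in> I \<Longrightarrow> f i \<in> hom_polys (n i)"
  shows "(\<lambda>X. if X \<in> sym_mats then \<Prod>i\<in>I. f i X else 0) \<in> hom_polys (\<Sum>i\<in>I. n i)"
  using assms
proof (induction I rule: finite_induct)
  case empty
  show ?case using prod_linear_in_hom_polys[of "{}" "\<lambda>_. 0"]
    by (simp add: sym_mats_def cong: if_cong)
next
  case (insert i I)
  have eq: "(\<lambda>X. if X \<in> sym_mats then \<Prod>i\<in>insert i I. f i X else 0) =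
      (\<lambda>X. f i X * (if X \<in> sym_mats then \<Prod>i\<in>I. f i X else 0))"
    using insert.hyps by (auto simp: fun_eq_iff)
  have "f i \<in> hom_polys (n i)" using insert.prems by simp
  moreover have "(\<lambda>X. if X \<in> sym_mats then \<Prod>i\<in>I. f i X else 0) \<in> hom_polys (\<Sum>i\<in>I. n i)"
    using insert.prems by (intro insert.IH) simp
  ultimately show ?case
    unfolding eq sum.insert[OF insert.hyps] by (rule hom_polys_mult)
qed

lemma entry_in_hom_polys:
  fixes i j :: "'n::finite"
  shows "(\<lambda>X. if X \<in> sym_mats then X $ i $ j else 0) \<in> hom_polys 1"
proof -
  define E :: "real^'n^'n" where
    "E = (1 / 2) *\<^sub>R (axis i (axis j 1) + axis j (axis i 1))"
  have E: "E \<in> sym_mats"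
    by (auto simp: E_def sym_mats_def transpose_def vec_eq_iff axis_def)
  have "E \<bullet> X = X $ i $ j" if X: "X \<in> sym_mats" for X
  proof -
    have "transpose X $ i $ j = X $ i $ j"
      using X by (simp add: sym_mats_def)
    then have "X $ i $ j = X $ j $ i" by (simp add: transpose_def)
    moreover have "E \<bullet> X = (X $ i $ j + X $ j $ i) / 2"
      by (simp add: E_def inner_add_left inner_axis')
    ultimately show ?thesis by simp
  qed
  then have eq: "(\<lambda>X. if X \<in> sym_mats then X $ i $ j else 0) = pow_kernel 1 E"
    by (simp add: pow_kernel_def fun_eq_iff)
  show ?thesis unfolding eq by (rule tk.k_in_V[OF E])
qed

lemma hom_polys_scaleR:
  assumes "f \<in> hom_polys t" "X \<in> sym_mats"
  shows "f (c *\<^sub>R X) = c ^ t * f X"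
proof -
  have c: "c *\<^sub>R X \<in> sym_mats"
    using assms(2) by (auto simp: sym_mats_def transpose_def vec_eq_iff)
  show ?thesis
    using assms(1) unfolding tk.V_def
    by (induction rule: fs.span_induct_alt)
      (auto simp: fun_applies pow_kernel_def c assms(2) power_mult_distrib algebra_simps)
qed

lemma hom_polys_polynomial:
  assumes "f \<in> hom_polys t"
  shows "\<exists>q. real_polynomial_function q \<and> (\<forall>X\<in>sym_mats. f X = q X)"
  using assms unfolding tk.V_def
proof (induction rule: fs.span_induct_alt)
  case base
  show ?case by (intro exI[of _ "\<lambda>X. 0"]) (auto simp: fun_applies)
next
  case (step c k f)
  then obtain Y q where "k = pow_kernel t Y" and q: "real_polynomial_function q" "\<forall>X\<in>sym_mats. f X = q X"
    by auto
  moreover have "real_polynomial_function (\<lambda>X. c * (Y \<bullet> X) ^ t + q X)"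
    by (intro real_polynomial_function.intros(2-) real_polynomial_function_power
        real_polynomial_function.intros(1) q bounded_linear_inner_right)
  ultimately show ?case
    by (intro exI[of _ "\<lambda>X. c * (Y \<bullet> X) ^ t + q X"]) (simp add: fun_applies pow_kernel_def)
qed

lemma hom_polys_subset_sym_hom_polys: "hom_polys t \<subseteq> sym_hom_polys t"
proof
  fix f :: "real^'n^'n \<Rightarrow> real" assume f: "f \<in> hom_polys t"
  show "f \<in> sym_hom_polys t"
    unfolding sym_hom_polys_def mem_Collect_eq
    using hom_polys_polynomial[OF f] hom_polys_scaleR[OF f] tk.V_off[OF f] by simp
qed

section \<open>The action of the general linear group\<close>

lemma inner_congruence:
  fixes g X Y :: "real^'n^'n"
  shows "Y \<bullet> (transpose g ** X ** g) = (g ** Y ** transpose g) \<bullet> X"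
proof -
  have "trace_inner Y (transpose g ** X ** g) = trace ((Y ** transpose g ** transpose X) ** g)"
    by (simp add: trace_inner_def matrix_transpose_mul matrix_mul_assoc)
  also have "\<dots> = trace (g ** (Y ** transpose g ** transpose X))"
    by (rule trace_mul_sym)
  also have "\<dots> = trace_inner (g ** Y ** transpose g) X"
    by (simp add: trace_inner_def matrix_mul_assoc)
  finally show ?thesis by (simp add: trace_inner_eq_inner)
qed

lemma sym_congruence: "X \<in> sym_mats \<Longrightarrow> transpose g ** X ** g \<in> sym_mats"
  by (simp add: sym_mats_def matrix_transpose_mul matrix_mul_assoc)

lemma sym_congruence_iff:
  fixes g X :: "real^'n^'n"
  assumes "invertible g"
  shows "transpose g ** X ** g \<in> sym_mats \<longleftrightarrow> X \<in> sym_mats"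
proof
  assume A: "transpose g ** X ** g \<in> sym_mats"
  obtain h where h: "g ** h = mat 1" "h ** g = mat 1"
    using assms unfolding invertible_def by blast
  have "transpose h ** transpose g = mat 1"
    using h by (metis matrix_transpose_mul transpose_mat)
  then have "transpose h ** (transpose g ** X ** g) ** h = X"
    using h(1) by (simp add: matrix_mul_assoc) (metis matrix_mul_assoc matrix_mul_rid)
  then show "X \<in> sym_mats" using sym_congruence[OF A, of h] by simp
qed (rule sym_congruence)

lemma gl_act_linear:
  "gl_act g (p + q) = gl_act g p + gl_act g q"
  "gl_act g (p - q) = gl_act g p - gl_act g q"
  "gl_act g (fscale c p) = fscale c (gl_act g p)"
  "gl_act g 0 = 0"
  "gl_act g (\<Sum>i\<in>I. f i) = (\<Sum>i\<in>I. gl_act g (f i))"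
  by (auto simp: gl_act_def fun_eq_iff fun_applies)

lemma gl_act_mult: "gl_act g (gl_act h p) = gl_act (g ** h) p"
  by (simp add: gl_act_def matrix_transpose_mul matrix_mul_assoc)

lemma gl_act_one: "gl_act (mat 1) p = p"
  by (simp add: gl_act_def)

lemma gl_act_pow_kernel:
  assumes "invertible g"
  shows "gl_act g (pow_kernel t Y) = pow_kernel t (g ** Y ** transpose g)"
  by (simp add: gl_act_def pow_kernel_def fun_eq_iff sym_congruence_iff[OF assms]
      inner_congruence)

lemma sym_congruence': "X \<in> sym_mats \<Longrightarrow> g ** X ** transpose g \<in> sym_mats"
  using sym_congruence[of X "transpose g"] by simp

lemma gl_act_hom_polys:
  assumes "invertible g" "f \<in> hom_polys t"
  shows "gl_act g f \<in> hom_polys t"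
proof -
  have "f \<in> fs.span (pow_kernel t ` sym_mats)"
    using assms(2) by (simp only: tk.V_def)
  then show ?thesis
  proof (induction rule: fs.span_induct_alt)
    case base
    show ?case by (simp only: gl_act_linear fs.subspace_0[OF tk.subspace_V])
  next
    case (step c k f)
    obtain Y where Y: "k = pow_kernel t Y" "Y \<in> sym_mats" using step.hyps by blast
    have "gl_act g k \<in> hom_polys t"
      unfolding Y(1) gl_act_pow_kernel[OF assms(1)]
      by (intro tk.k_in_V sym_congruence' Y(2))
    then show ?case
      unfolding gl_act_linear using step.IH
      by (intro fs.subspace_add fs.subspace_scale tk.subspace_V)
  qed
qed

text \<open>
  The inner product is not invariant under the group, but it turns the transpose of a matrix into
  the adjoint of its action.  As the group is closed under transposition, orthogonal complements
  of subrepresentations are subrepresentations.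
\<close>

lemma ip_gl_act:
  assumes "invertible g" "p \<in> hom_polys t" "q \<in> hom_polys t"
  shows "tk.ip t (gl_act g p) q = tk.ip t p (gl_act (transpose g) q)"
proof -
  have gt: "invertible (transpose g)" using assms(1) by (rule transpose_invertible)
  have q': "gl_act (transpose g) q \<in> hom_polys t"
    by (rule gl_act_hom_polys[OF gt assms(3)])
  have K: "tk.ip t (gl_act g (pow_kernel t Y)) q = tk.ip t (pow_kernel t Y) (gl_act (transpose g) q)"
    if "Y \<in> sym_mats" for Y
    using that
    by (simp add: gl_act_pow_kernel[OF assms(1)] tk.ip_kernel sym_congruence' assms(3) q')
      (simp add: gl_act_def)
  have "p \<in> fs.span (pow_kernel t ` sym_mats)"
    using assms(2) by (simp only: tk.V_def)
  then have "p \<in> hom_polys t \<and> tk.ip t (gl_act g p) q = tk.ip t p (gl_act (transpose g) q)"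
  proof (induction rule: fs.span_induct_alt)
    case base
    have z: "0 \<in> hom_polys t" by (rule fs.subspace_0[OF tk.subspace_V])
    have "tk.ip t 0 q = 0" "tk.ip t 0 (gl_act (transpose g) q) = 0"
      using tk.ip_commute[OF z] assms(3) q' by simp_all
    then show ?case using z by (simp add: gl_act_linear)
  next
    case (step c k f)
    obtain Y where Y: "k = pow_kernel t Y" "Y \<in> sym_mats" using step.hyps by blast
    have k: "k \<in> hom_polys t" unfolding Y(1) by (rule tk.k_in_V[OF Y(2)])
    have ck: "fscale c k \<in> hom_polys t" by (rule fs.subspace_scale[OF tk.subspace_V k])
    have f: "f \<in> hom_polys t" using step.IH by simp
    have g: "gl_act g k \<in> hom_polys t" "gl_act g f \<in> hom_polys t"
      by (rule gl_act_hom_polys[OF assms(1)] k f)+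
    have cg: "fscale c (gl_act g k) \<in> hom_polys t" by (rule fs.subspace_scale[OF tk.subspace_V g(1)])
    have "tk.ip t (gl_act g (fscale c k + f)) q =
        c * tk.ip t (gl_act g k) q + tk.ip t (gl_act g f) q"
      by (simp add: gl_act_linear tk.ip_add_left[OF cg g(2) assms(3)]
          tk.ip_scale_left[OF g(1) assms(3)])
    also have "\<dots> = c * tk.ip t k (gl_act (transpose g) q) + tk.ip t f (gl_act (transpose g) q)"
      using step.IH K[OF Y(2)] Y(1) by simp
    also have "\<dots> = tk.ip t (fscale c k + f) (gl_act (transpose g) q)"
      by (simp add: tk.ip_add_left[OF ck f q'] tk.ip_scale_left[OF k q'])
    finally show ?case
      using fs.subspace_add[OF tk.subspace_V ck f] by simp
  qed
  then show ?thesis by simp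
qed

section \<open>Matrix factorizations near the identity\<close>

text \<open>
  A polynomial vanishing near \<open>x0\<close> vanishes on every line through \<open>x0\<close>, since it has infinitely
  many zeros there.
\<close>

lemma polynomial_zero_on_line:
  fixes q :: "'v::euclidean_space \<Rightarrow> real"
  assumes q: "real_polynomial_function q" and U: "open U" "x0 \<in> U"
    and zero: "\<And>s. x0 + s *\<^sub>R z \<in> U \<Longrightarrow> q (x0 + s *\<^sub>R z) = 0"
  shows "q (x0 + z) = 0"
proof -
  define l where "l = (\<lambda>s::real. x0 + s *\<^sub>R z)"
  have "polynomial_function l"
    unfolding l_def
    by (intro polynomial_function_add polynomial_function_const polynomial_function_bounded_linear
        bounded_linear_scaleR_left)
  then have "real_polynomial_function (q \<circ> l)"
    by (rule real_polynomial_function_compose) (rule q)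
  then obtain a n where a: "q \<circ> l = (\<lambda>s. \<Sum>i\<le>n. a i * s ^ i)"
    using real_polynomial_function_iff_sum by blast
  have "continuous_on UNIV l" unfolding l_def by (intro continuous_intros)
  then have "open (l -` U)" using U(1) by (simp add: open_vimage)
  moreover have "0 \<in> l -` U" using U(2) by (simp add: l_def)
  ultimately have "infinite (l -` U)"
    using empty_interior_finite[of "l -` U"] interior_open[of "l -` U"] by auto
  moreover have "l -` U \<subseteq> {s. (\<Sum>i\<le>n. a i * s ^ i) = 0}"
  proof
    fix s assume "s \<in> l -` U"
    then have "(q \<circ> l) s = 0" using zero by (simp add: l_def)
    then show "s \<in> {s. (\<Sum>i\<le>n. a i * s ^ i) = 0}" by (simp add: a)
  qed
  ultimately have "\<forall>i\<le>n. a i = 0"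
    using polyfun_finite_roots[of a n] finite_subset by blast
  then have "(q \<circ> l) 1 = 0" by (simp add: a)
  then show ?thesis by (simp add: l_def)
qed

lemma polynomial_zero_of_zero_near:
  fixes q :: "real^'n^'n \<Rightarrow> real"
  assumes q: "real_polynomial_function q" and U: "open U" "mat 1 \<in> U"
    and zero: "\<And>X. X \<in> U \<Longrightarrow> q X = 0"
  shows "q X = 0"
  using polynomial_zero_on_line[OF q U, of "X - mat 1"] zero by simp

lemma polynomial_zero_of_zero_near_sym:
  fixes q :: "real^'n^'n \<Rightarrow> real"
  assumes q: "real_polynomial_function q" and U: "open U" "mat 1 \<in> U"
    and zero: "\<And>X. X \<in> U \<Longrightarrow> X \<in> sym_mats \<Longrightarrow> q X = 0"
    and X: "X \<in> sym_mats"
  shows "q X = 0"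
proof -
  have "mat 1 + s *\<^sub>R (X - mat 1) \<in> sym_mats" for s
    using X by (auto simp: sym_mats_def transpose_def vec_eq_iff mat_def)
  then show ?thesis
    using polynomial_zero_on_line[OF q U, of "X - mat 1"] zero by simp
qed

lemma bounded_bilinear_matrix_mult:
  "bounded_bilinear ((**) :: real^'n^'n \<Rightarrow> real^'n^'n \<Rightarrow> real^'n^'n)"
proof -
  have "bilinear ((**) :: real^'n^'n \<Rightarrow> real^'n^'n \<Rightarrow> real^'n^'n)"
    by (auto simp: bilinear_def linear_iff matrix_matrix_mult_def vec_eq_iff sum_distrib_left algebra_simps sum.distrib)
  then show ?thesis by (simp add: bilinear_conv_bounded_bilinear)
qed

lemma open_invertible: "open {X :: real^'n^'n. invertible X}"
proof -
  have "continuous_on UNIV (det :: real^'n^'n \<Rightarrow> real)"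
    unfolding det_def by (intro continuous_intros)
  then have "open (det -` (- {0}) :: (real^'n^'n) set)"
    by (intro open_vimage) auto
  moreover have "det -` (- {0}) = {X :: real^'n^'n. invertible X}"
    by (auto simp: invertible_det_nz)
  ultimately show ?thesis by simp
qed

definition upper :: "real^'n::{finite,linorder}^'n::_ \<Rightarrow> bool" where
  "upper b \<longleftrightarrow> (\<forall>i j. j < i \<longrightarrow> b $ i $ j = 0)"

definition lower_part :: "real^'n::{finite,linorder}^'n::_ \<Rightarrow> real^'n::_^'n::_" where
  "lower_part M = (\<chi> i j. if j < i then M $ i $ j else 0)"

lemma linear_lower_part: "linear lower_part"
  by (auto simp: linear_iff lower_part_def vec_eq_iff)

lemma bounded_linear_lower_part [bounded_linear]: "bounded_linear lower_part"
  using linear_lower_part by (simp add: linear_conv_bounded_linear)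

lemma bounded_linear_transpose: "bounded_linear (transpose :: real^'n^'n \<Rightarrow> real^'n^'n)"
  by (auto simp: linear_conv_bounded_linear[symmetric] linear_iff transpose_def vec_eq_iff)

text \<open>
  Both factorizations come from the open mapping property of a map whose derivative at \<open>0\<close> is
  onto: perturbations of the factors realize all perturbations of the product to first order.
\<close>

lemma lower_upper_near_one:
  "\<exists>U. open U \<and> mat 1 \<in> U \<and> (\<forall>X\<in>U. \<exists>l b :: real^'n::{finite,linorder}^'n::_.
     invertible l \<and> invertible b \<and> upper (transpose l) \<and> upper b \<and> X = l ** b)"
proof -
  interpret mm: bounded_bilinear "(**) :: real^'n::_^'n::_ \<Rightarrow> real^'n::_^'n::_ \<Rightarrow> real^'n::_^'n::_"
    by (rule bounded_bilinear_matrix_mult)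
  define f where "f = (\<lambda>M :: real^'n::_^'n::_. (mat 1 + lower_part M) ** (mat 1 + (M - lower_part M)))"
  have der: "(f has_derivative id) (at 0)"
    unfolding f_def
    by (rule has_derivative_eq_rhs, rule mm.FDERIV)
      (auto intro!: derivative_eq_intros bounded_linear_imp_has_derivative bounded_linear_lower_part
        simp: linear_0[OF linear_lower_part] fun_eq_iff)
  have cont: "continuous_on UNIV f"
    unfolding f_def
    by (intro mm.continuous_on continuous_intros bounded_linear.continuous_on bounded_linear_lower_part)
  have "f 0 \<in> interior (f ` UNIV)"
    by (rule sussmann_open_mapping[OF open_UNIV cont _ der bounded_linear_ident]) (auto simp: fun_eq_iff)
  then have one: "mat 1 \<in> interior (range f)"
    by (simp add: f_def linear_0[OF linear_lower_part])
  define U where "U = interior (range f) \<inter> {X. invertible X}"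
  have "open U" unfolding U_def by (intro open_Int open_interior open_invertible)
  moreover have "mat 1 \<in> U" using one by (simp add: U_def invertible_det_nz)
  moreover have "\<exists>l b :: real^'n::_^'n::_. invertible l \<and> invertible b \<and> upper (transpose l) \<and> upper b \<and> X = l ** b"
    if XU: "X \<in> U" for X
  proof -
    obtain M where M: "X = f M" using XU interior_subset unfolding U_def by blast
    let ?l = "mat 1 + lower_part M" and ?b = "mat 1 + (M - lower_part M)"
    have X: "X = ?l ** ?b" using M by (simp add: f_def)
    have "det ?l * det ?b \<noteq> 0"
      using XU X by (simp add: U_def invertible_det_nz det_mul)
    then have "invertible ?l" "invertible ?b" by (simp_all add: invertible_det_nz)
    moreover have "upper (transpose ?l)" "upper ?b"
      by (auto simp: upper_def transpose_def lower_part_def mat_def)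
    ultimately show ?thesis using X by blast
  qed
  ultimately show ?thesis by blast
qed

lemma cholesky_near_one:
  "\<exists>U. open U \<and> mat 1 \<in> U \<and> (\<forall>X\<in>U. X \<in> sym_mats \<longrightarrow>
     (\<exists>b :: real^'n::{finite,linorder}^'n::_. invertible b \<and> upper b \<and> X = transpose b ** b))"
proof -
  interpret mm: bounded_bilinear "(**) :: real^'n::_^'n::_ \<Rightarrow> real^'n::_^'n::_ \<Rightarrow> real^'n::_^'n::_"
    by (rule bounded_bilinear_matrix_mult)
  define u where "u = (\<lambda>M :: real^'n::_^'n::_. M - lower_part M)"
  define a where "a = (\<lambda>M :: real^'n::_^'n::_. lower_part M - transpose (lower_part M))"
  have u: "bounded_linear u" unfolding u_def
    by (intro bounded_linear_sub bounded_linear_ident bounded_linear_lower_part)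
  have tu: "bounded_linear (\<lambda>M. transpose (u M))"
    by (rule bounded_linear_compose[OF bounded_linear_transpose u])
  have a: "bounded_linear a" unfolding a_def
    by (intro bounded_linear_sub bounded_linear_lower_part
        bounded_linear_compose[OF bounded_linear_transpose])
  have z: "u 0 = 0" "a 0 = 0" using u a by (auto simp: linear_0 bounded_linear.linear)
  have tz: "transpose (0 :: real^'n::_^'n::_) = 0" by (simp add: transpose_def vec_eq_iff)
  \<comment> \<open>the skew-symmetric summand makes the derivative onto all matrices; it vanishes whenever the
    value is symmetric\<close>
  define f where "f = (\<lambda>M. (mat 1 + transpose (u M)) ** (mat 1 + u M) + a M)"
  define f' where "f' = (\<lambda>M. u M + transpose (u M) + a M)"
  define g' where "g' = (\<lambda>Z :: real^'n::_^'n::_. \<chi> i j.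
      if i = j then Z $ i $ i / 2 else if i < j then (Z $ i $ j + Z $ j $ i) / 2
      else (Z $ i $ j - Z $ j $ i) / 2)"
  have der: "(f has_derivative f') (at 0)"
    unfolding f_def f'_def
    by (rule has_derivative_eq_rhs, rule has_derivative_add, rule mm.FDERIV)
      (auto intro!: derivative_eq_intros bounded_linear_imp_has_derivative u a tu
        simp: z tz fun_eq_iff)
  have cont: "continuous_on UNIV f"
    unfolding f_def
    by (intro mm.continuous_on continuous_intros linear_continuous_on u a tu)
  have g': "bounded_linear g'"
    unfolding linear_conv_bounded_linear[symmetric]
    by (auto simp: linear_iff g'_def vec_eq_iff field_simps)
  have inv: "f' \<circ> g' = id"
    by (auto simp: fun_eq_iff f'_def g'_def u_def a_def lower_part_def transpose_def vec_eq_iff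
        field_simps)
  have "f 0 \<in> interior (f ` UNIV)"
    by (rule sussmann_open_mapping[OF open_UNIV cont _ der g' inv]) auto
  then have one: "mat 1 \<in> interior (range f)"
    by (simp add: f_def z tz)
  define U where "U = interior (range f) \<inter> {X. invertible X}"
  have "open U" unfolding U_def by (intro open_Int open_interior open_invertible)
  moreover have "mat 1 \<in> U" using one by (simp add: U_def invertible_det_nz)
  moreover have "\<exists>b :: real^'n::_^'n::_. invertible b \<and> upper b \<and> X = transpose b ** b"
    if XU: "X \<in> U" "X \<in> sym_mats" for X
  proof -
    obtain M where M: "X = f M" using XU interior_subset unfolding U_def by blast
    let ?b = "mat 1 + u M"
    have tb: "transpose ?b = mat 1 + transpose (u M)"
      by (simp add: transpose_def vec_eq_iff mat_def)
    have X: "X = transpose ?b ** ?b + a M" using M by (simp add: f_def tb)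
    have "transpose (transpose ?b ** ?b + a M) = transpose ?b ** ?b - a M"
      by (simp add: matrix_transpose_mul a_def vec_eq_iff transpose_def
          matrix_matrix_mult_def mult.commute)
    moreover have "transpose (transpose ?b ** ?b + a M) = transpose ?b ** ?b + a M"
      using XU(2) by (simp add: sym_mats_def X[symmetric])
    ultimately have "a M = - a M" by (simp add: algebra_simps)
    then have "a M = 0" by (simp add: vec_eq_iff)
    then have X: "X = transpose ?b ** ?b" using X by simp
    have "det (transpose ?b) * det ?b \<noteq> 0"
      using XU X by (simp add: U_def invertible_det_nz det_mul)
    then have "invertible ?b" by (simp add: invertible_det_nz)
    moreover have "upper ?b"
      by (auto simp: upper_def u_def lower_part_def mat_def)
    ultimately show ?thesis using X by blast
  qed
  ultimately show ?thesis by blast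
qed

section \<open>Principal minors and highest weight vectors\<close>

lemma sum_fun_nat_le: "(\<pi> :: 'n::finite \<Rightarrow> nat) i \<le> (\<Sum>j\<in>UNIV. \<pi> j)"
  by (rule member_le_sum) auto

text \<open>
  The entries with both indices in \<open>A\<close> are kept, the others are those of the identity.  This gives
  principal minors as determinants without changing the type of the matrix.
\<close>

definition block :: "'n set \<Rightarrow> real^'n^'n \<Rightarrow> real^'n^'n" where
  "block A X = (\<chi> i j. if i \<in> A \<and> j \<in> A then X $ i $ j else if i = j then 1 else 0)"

definition minor :: "'n set \<Rightarrow> real^'n^'n \<Rightarrow> real" where
  "minor A X = (if X \<in> sym_mats then det (block A X) else 0)"

text \<open>
  Completed blocks multiply as the matrices do if one of the factors does not mix indices inside
  \<open>A\<close> with indices outside, as is the case for a triangular factor and an initial segment \<open>A\<close>.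
\<close>

lemma block_mult:
  fixes X Y :: "real^'n^'n"
  assumes "(\<forall>i\<in>A. \<forall>k. k \<notin> A \<longrightarrow> X $ i $ k = 0) \<or> (\<forall>k. k \<notin> A \<longrightarrow> (\<forall>j\<in>A. Y $ k $ j = 0))"
  shows "block A (X ** Y) = block A X ** block A Y"
proof -
  have "block A (X ** Y) $ i $ j = (block A X ** block A Y) $ i $ j" for i j
  proof (cases "i \<in> A")
    case i: True
    show ?thesis
    proof (cases "j \<in> A")
      case True
      have "X $ i $ k * Y $ k $ j = (block A X) $ i $ k * (block A Y) $ k $ j" for k
        using assms i True by (auto simp: block_def)
      then show ?thesis
        using i True by (simp add: matrix_matrix_mult_def) (simp add: block_def)
    next
      case False
      have "(block A X) $ i $ k * (block A Y) $ k $ j = 0" for k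
        using i False by (auto simp: block_def)
      then have "(block A X ** block A Y) $ i $ j = 0"
        by (simp only: matrix_matrix_mult_def vec_lambda_beta sum.neutral_const)
      then show ?thesis using i False by (auto simp: block_def)
    qed
  next
    case False
    have "(block A X) $ i $ k * (block A Y) $ k $ j = (if k = i then block A Y $ i $ j else 0)" for k
      using False by (auto simp: block_def)
    then have "(block A X ** block A Y) $ i $ j = block A Y $ i $ j"
      by (simp add: matrix_matrix_mult_def)
    then show ?thesis using False by (simp add: block_def)
  qed
  then show ?thesis by (simp add: vec_eq_iff)
qed

text \<open>
  A permutation other than the identity moves its largest moved index down, so it picks an entry
  below the diagonal.
\<close>

lemma det_upper:
  fixes b :: "real^'n::{finite,linorder}^'n::_"
  assumes "upper b"
  shows "det b = (\<Prod>i\<in>UNIV. b $ i $ i)"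
proof -
  have "(\<Prod>i\<in>UNIV. b $ i $ p i) = 0" if p: "p permutes UNIV" "p \<noteq> id" for p
  proof -
    define m where "m = Max {i. p i \<noteq> i}"
    have "{i. p i \<noteq> i} \<noteq> {}" using p(2) by (auto simp: fun_eq_iff)
    then have m: "p m \<noteq> m" using Max_in[of "{i. p i \<noteq> i}"] by (simp add: m_def)
    have "p (p m) \<noteq> p m" using m permutes_inj[OF p(1)] by (auto dest: injD)
    then have "p m \<le> m" unfolding m_def by (intro Max_ge) (auto simp: m_def)
    then have "b $ m $ p m = 0" using assms m by (simp add: upper_def)
    then show ?thesis by (intro prod_zero) auto
  qed
  then have "det b = (\<Sum>p\<in>{p. p permutes (UNIV :: 'n set)}. if p = id then \<Prod>i\<in>UNIV. b $ i $ i else 0)"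
    unfolding det_def by (intro sum.cong) auto
  then show ?thesis by (simp add: permutes_id)
qed

lemma minor_upper_congruence:
  fixes b X :: "real^'n::{finite,linorder}^'n::_"
  assumes b: "upper b" "invertible b" and A: "\<And>i j. j \<in> A \<Longrightarrow> i \<le> j \<Longrightarrow> i \<in> A"
  shows "minor A (transpose b ** X ** b) = (\<Prod>i\<in>A. (b $ i $ i)\<^sup>2) * minor A X"
proof -
  have b0: "b $ k $ j = 0" if "k \<notin> A" "j \<in> A" for k j
  proof -
    have "j < k" using A[OF that(2), of k] that(1) by (meson not_le)
    then show ?thesis using b(1) by (simp add: upper_def)
  qed
  have "block A (transpose b ** X ** b) = block A (transpose b ** X) ** block A b"
    by (rule block_mult) (use b0 in auto)
  also have "block A (transpose b ** X) = block A (transpose b) ** block A X"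
    by (rule block_mult) (use b0 in \<open>auto simp: transpose_def\<close>)
  also have "block A (transpose b) = transpose (block A b)"
    by (auto simp: block_def transpose_def vec_eq_iff)
  finally have "det (block A (transpose b ** X ** b)) = (det (block A b))\<^sup>2 * det (block A X)"
    by (simp add: det_mul power2_eq_square)
  moreover have "det (block A b) = (\<Prod>i\<in>UNIV. block A b $ i $ i)"
    by (rule det_upper) (use b(1) in \<open>auto simp: upper_def block_def\<close>)
  moreover have "(\<Prod>i\<in>UNIV. block A b $ i $ i) = (\<Prod>i\<in>A. b $ i $ i)"
    by (rule prod.mono_neutral_cong_right) (auto simp: block_def)
  ultimately show ?thesis
    by (simp add: minor_def sym_congruence_iff[OF b(2)] prod_power_distrib)
qed

text \<open>
  In the Leibniz expansion, a permutation moving an index outside \<open>A\<close> contributes \<open>0\<close>, and every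
  other one contributes a product of \<open>card A\<close> entries.
\<close>

lemma minor_in_hom_polys: "minor A \<in> hom_polys (card A)"
proof -
  define e where "e = (\<lambda>p X. if X \<in> sym_mats then \<Prod>i\<in>UNIV. block A X $ i $ p i else 0)"
  have e: "e p \<in> hom_polys (card A)" if p: "p permutes UNIV" for p
  proof (cases "\<forall>i. i \<notin> A \<longrightarrow> p i = i")
    case True
    have pA: "p i \<in> A" if "i \<in> A" for i
      using True that permutes_inj[OF p] by (metis injD)
    have "(\<Prod>i\<in>UNIV. block A X $ i $ p i) =
        (\<Prod>i\<in>A. X $ i $ p i)" for X
      using True pA by (intro prod.mono_neutral_cong_right) (auto simp: block_def)
    then have eq: "e p = (\<lambda>X. if X \<in> sym_mats then
        \<Prod>i\<in>A. (\<lambda>X. if X \<in> sym_mats then X $ i $ p i else 0) X else 0)"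
      by (simp add: e_def fun_eq_iff)
    show ?thesis
      unfolding eq using hom_polys_prod[of A _ "\<lambda>_. 1", OF _ entry_in_hom_polys] by simp
  next
    case False
    then obtain i where "i \<notin> A" "p i \<noteq> i" by blast
    then have "(\<Prod>i\<in>UNIV. block A X $ i $ p i) = 0" for X
      by (intro prod_zero bexI[of _ i]) (auto simp: block_def)
    then have "e p = 0" by (simp add: e_def fun_eq_iff fun_applies)
    then show ?thesis using fs.subspace_0[OF tk.subspace_V] by simp
  qed
  have "minor A = (\<Sum>p\<in>{p. p permutes UNIV}. fscale (of_int (sign p)) (e p))"
    by (auto simp: fun_eq_iff minor_def det_def e_def fun_applies)
  also have "\<dots> \<in> hom_polys (card A)"
    using e by (intro fs.subspace_sum fs.subspace_scale tk.subspace_V) auto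
  finally show ?thesis .
qed

lemma minor_one: "minor A (mat 1) = 1"
proof -
  have "block A (mat 1) = mat 1" by (auto simp: block_def mat_def vec_eq_iff)
  then show ?thesis by (simp add: minor_def sym_mats_def)
qed

text \<open>
  The product over the columns of the diagram of \<open>\<pi>\<close> of the leading principal minors whose size is
  the length of the column.  The columns to the right of the diagram are empty and contribute \<open>1\<close>.
\<close>

definition hw_vector :: "('n::{finite,linorder} \<Rightarrow> nat) \<Rightarrow> real^'n::_^'n::_ \<Rightarrow> real" where
  "hw_vector \<pi> X = (if X \<in> sym_mats then \<Prod>s=1..(\<Sum>i\<in>UNIV. \<pi> i). minor {i. s \<le> \<pi> i} X else 0)"

text \<open>
  The degree is the number of boxes of the diagram, counted by columns and then by rows.
\<close>

lemma hw_vector_in_hom_polys: "hw_vector \<pi> \<in> hom_polys (\<Sum>i\<in>UNIV. \<pi> i)"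
proof -
  let ?T = "\<Sum>i\<in>UNIV. \<pi> i"
  have "(\<Sum>s=1..?T. card {i. s \<le> \<pi> i}) = (\<Sum>s=1..?T. \<Sum>i\<in>UNIV. if s \<le> \<pi> i then 1 else 0)"
    by (simp add: sum.If_cases)
  also have "\<dots> = (\<Sum>i\<in>UNIV. \<Sum>s=1..?T. if s \<le> \<pi> i then 1 else 0)"
    by (rule sum.swap)
  also have "\<dots> = ?T"
  proof (rule sum.cong[OF refl])
    fix i
    have "{1..?T} \<inter> {s. s \<le> \<pi> i} = {1..\<pi> i}"
      using sum_fun_nat_le[of \<pi> i] by auto
    then show "(\<Sum>s=1..?T. if s \<le> \<pi> i then 1 else 0) = \<pi> i"
      by (simp add: sum.If_cases)
  qed
  finally have T: "(\<Sum>s=1..?T. card {i. s \<le> \<pi> i}) = ?T" .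
  have eq: "hw_vector \<pi> = (\<lambda>X. if X \<in> sym_mats then \<Prod>s\<in>{1..?T}. minor {i. s \<le> \<pi> i} X else 0)"
    by (simp add: fun_eq_iff hw_vector_def)
  have "(\<lambda>X. if X \<in> sym_mats then \<Prod>s\<in>{1..?T}. minor {i. s \<le> \<pi> i} X else 0)
      \<in> hom_polys (\<Sum>s=1..?T. card {i. s \<le> \<pi> i})"
    by (rule hom_polys_prod) (auto intro: minor_in_hom_polys)
  then show ?thesis unfolding T eq .
qed

lemma hw_vector_one: "hw_vector \<pi> (mat 1) = 1"
  by (simp add: hw_vector_def minor_one sym_mats_def)

definition semi_invariant :: "('n \<Rightarrow> nat) \<Rightarrow> (real^'n::{finite,linorder}^'n::_ \<Rightarrow> real) \<Rightarrow> bool" where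
  "semi_invariant \<alpha> v \<longleftrightarrow>
     (\<forall>b. invertible b \<and> upper b \<longrightarrow> gl_act b v = fscale (\<Prod>i\<in>UNIV. (b $ i $ i) ^ \<alpha> i) v)"

lemma has_highest_weight_iff:
  "has_highest_weight V \<alpha> \<longleftrightarrow> (\<exists>v\<in>V. v \<noteq> 0 \<and> semi_invariant \<alpha> v)"
  by (simp add: has_highest_weight_def semi_invariant_def upper_def fscale_def zero_fun_def)

lemma semi_invariant_hw_vector:
  fixes \<pi> :: "'n::{finite,linorder} \<Rightarrow> nat"
  assumes "antimono \<pi>"
  shows "semi_invariant (\<lambda>i. 2 * \<pi> i) (hw_vector \<pi>)"
  unfolding semi_invariant_def
proof (intro allI impI ext)
  fix b X :: "real^'n::_^'n::_" assume b: "invertible b \<and> upper b"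
  let ?T = "\<Sum>i\<in>UNIV. \<pi> i"
  have "minor {i. s \<le> \<pi> i} (transpose b ** X ** b) =
      (\<Prod>i\<in>{i. s \<le> \<pi> i}. (b $ i $ i)\<^sup>2) * minor {i. s \<le> \<pi> i} X" for s
    by (rule minor_upper_congruence)
      (use b assms in \<open>auto simp: antimono_def intro: order_trans\<close>)
  moreover have "(\<Prod>s=1..?T. \<Prod>i\<in>{i. s \<le> \<pi> i}. (b $ i $ i)\<^sup>2) = (\<Prod>i\<in>UNIV. (b $ i $ i) ^ (2 * \<pi> i))"
  proof -
    have "(\<Prod>s=1..?T. \<Prod>i\<in>{i. s \<le> \<pi> i}. (b $ i $ i)\<^sup>2) =
        (\<Prod>s=1..?T. \<Prod>i\<in>UNIV. if s \<le> \<pi> i then (b $ i $ i)\<^sup>2 else 1)"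
      by (simp add: prod.If_cases)
    also have "\<dots> = (\<Prod>i\<in>UNIV. \<Prod>s=1..?T. if s \<le> \<pi> i then (b $ i $ i)\<^sup>2 else 1)"
      by (rule prod.swap)
    also have "\<dots> = (\<Prod>i\<in>UNIV. (b $ i $ i) ^ (2 * \<pi> i))"
    proof (rule prod.cong[OF refl])
      fix i
      have "{1..?T} \<inter> {s. s \<le> \<pi> i} = {1..\<pi> i}"
        using sum_fun_nat_le[of \<pi> i] by auto
      then show "(\<Prod>s=1..?T. if s \<le> \<pi> i then (b $ i $ i)\<^sup>2 else 1) = (b $ i $ i) ^ (2 * \<pi> i)"
        by (simp add: prod.If_cases power_mult)
    qed
    finally show ?thesis .
  qed
  ultimately show "gl_act b (hw_vector \<pi>) X =
      fscale (\<Prod>i\<in>UNIV. (b $ i $ i) ^ (2 * \<pi> i)) (hw_vector \<pi>) X"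
    using b by (simp add: gl_act_def hw_vector_def fscale_apply sym_congruence_iff prod.distrib)
qed

text \<open>
  A semi-invariant of given weight is determined by its value at the identity on all products
  \<open>b\<^sup>T b\<close> with \<open>b\<close> upper triangular, hence near the identity, hence everywhere.
\<close>

lemma semi_invariant_unique:
  fixes v w :: "real^'n::{finite,linorder}^'n::_ \<Rightarrow> real"
  assumes v: "semi_invariant \<alpha> v" "v \<in> sym_hom_polys s"
    and w: "semi_invariant \<alpha> w" "w \<in> sym_hom_polys t" "w (mat 1) = 1"
  shows "v = fscale (v (mat 1)) w"
proof
  fix X :: "real^'n::_^'n::_"
  obtain q where q: "real_polynomial_function q" "\<And>X. X \<in> sym_mats \<Longrightarrow> v X = q X"
    using v(2) unfolding sym_hom_polys_def by blast
  obtain r where r: "real_polynomial_function r" "\<And>X. X \<in> sym_mats \<Longrightarrow> w X = r X"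
    using w(2) unfolding sym_hom_polys_def by blast
  obtain U :: "(real^'n::_^'n::_) set" where U: "open U" "mat 1 \<in> U"
    "\<And>X. X \<in> U \<Longrightarrow> X \<in> sym_mats \<Longrightarrow> \<exists>b. invertible b \<and> upper b \<and> X = transpose b ** b"
    using cholesky_near_one by metis
  let ?d = "\<lambda>X. q X - v (mat 1) * r X"
  have near: "?d X = 0" if X: "X \<in> U" "X \<in> sym_mats" for X
  proof -
    obtain b where b: "invertible b" "upper b" "X = transpose b ** b"
      using U(3)[OF X] by blast
    have val: "u X = (\<Prod>i\<in>UNIV. (b $ i $ i) ^ \<alpha> i) * u (mat 1)" if "semi_invariant \<alpha> u" for u
    proof -
      have "gl_act b u = fscale (\<Prod>i\<in>UNIV. (b $ i $ i) ^ \<alpha> i) u"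
        using that b(1,2) by (simp add: semi_invariant_def)
      from fun_cong[OF this, of "mat 1"] show ?thesis
        by (simp add: gl_act_def fscale_apply b(3))
    qed
    from val[OF v(1)] val[OF w(1)] show ?thesis
      using q(2)[OF X(2)] r(2)[OF X(2)] w(3) by simp
  qed
  show "v X = fscale (v (mat 1)) w X"
  proof (cases "X \<in> sym_mats")
    case True
    have "real_polynomial_function ?d"
      by (intro real_polynomial_function_diff real_polynomial_function.intros(2,4) q r)
    from polynomial_zero_of_zero_near_sym[OF this U(1,2) near True]
    show ?thesis using q(2) r(2) True by (simp add: fscale_apply)
  next
    case False
    then show ?thesis
      using v(2) w(2) by (simp add: sym_hom_polys_def fscale_apply)
  qed
qed

section \<open>The irreducible constituents\<close>

lemma subrep_iff:
  "subrep t W \<longleftrightarrow> W \<subseteq> sym_hom_polys t \<and> fs.subspace W \<and>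
     (\<forall>g. invertible g \<longrightarrow> (\<forall>p\<in>W. gl_act g p \<in> W))"
  unfolding subrep_def fs.subspace_def by (simp add: plus_fun_def zero_fun_def fscale_def)

definition constituent :: "('n::{finite,linorder} \<Rightarrow> nat) \<Rightarrow> (real^'n::_^'n::_ \<Rightarrow> real) set" where
  "constituent \<pi> = fs.span ((\<lambda>g. gl_act g (hw_vector \<pi>)) ` {g. invertible g})"

lemma subspace_constituent: "fs.subspace (constituent \<pi>)"
  unfolding constituent_def by (rule fs.subspace_span)

lemma constituent_subset: "constituent \<pi> \<subseteq> hom_polys (\<Sum>i\<in>UNIV. \<pi> i)"
  unfolding constituent_def
  by (rule fs.span_minimal) (auto simp: tk.subspace_V gl_act_hom_polys hw_vector_in_hom_polys)

lemma hw_vector_in_constituent: "hw_vector \<pi> \<in> constituent \<pi>"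
proof -
  have "gl_act (mat 1) (hw_vector \<pi>) \<in> constituent \<pi>"
    unfolding constituent_def by (rule fs.span_base) (simp add: invertible_det_nz)
  then show ?thesis by (simp add: gl_act_one)
qed

lemma gl_act_constituent:
  assumes "invertible g" "p \<in> constituent \<pi>"
  shows "gl_act g p \<in> constituent \<pi>"
  using assms(2) unfolding constituent_def
proof (induction rule: fs.span_induct_alt)
  case base
  show ?case by (simp only: gl_act_linear fs.span_zero)
next
  case (step c k f)
  then obtain h where h: "k = gl_act h (hw_vector \<pi>)" "invertible h" by blast
  have "gl_act g k = gl_act (g ** h) (hw_vector \<pi>)" by (simp add: h(1) gl_act_mult)
  moreover have "invertible (g ** h)" using assms(1) h(2) by (rule invertible_mult)
  ultimately have "gl_act g k \<in> fs.span ((\<lambda>g. gl_act g (hw_vector \<pi>)) ` {g. invertible g})"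
    by (intro fs.span_base) auto
  then show ?case
    unfolding gl_act_linear using step.IH by (intro fs.span_add fs.span_scale)
qed

lemma subrep_constituent: "subrep (\<Sum>i\<in>UNIV. \<pi> i) (constituent \<pi>)"
  using constituent_subset[of \<pi>] hom_polys_subset_sym_hom_polys subspace_constituent
    gl_act_constituent
  unfolding subrep_iff by blast

lemma constituent_minimal:
  assumes "subrep t W" "hw_vector \<pi> \<in> W"
  shows "constituent \<pi> \<subseteq> W"
  unfolding constituent_def
  by (rule fs.span_minimal) (use assms in \<open>auto simp: subrep_iff\<close>)

lemma ip_orth_constituent:
  assumes "\<And>g. invertible g \<Longrightarrow> tk.ip t p (gl_act g (hw_vector \<pi>)) = 0" "q \<in> constituent \<pi>"
  shows "tk.ip t p q = 0"
  using assms(2) unfolding constituent_def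
  by (induction rule: fs.span_induct_alt)
    (auto simp: tk.ip_add_right tk.ip_scale_right assms(1))

text \<open>
  The components of a highest weight vector in a subrepresentation and in its orthogonal complement
  are semi-invariants of the same weight, hence multiples of the vector; so one of the two spaces
  contains it and with it the whole space that it generates.
\<close>

lemma irreducible_constituent:
  fixes \<pi> :: "'n::{finite,linorder} \<Rightarrow> nat"
  assumes "antimono \<pi>"
  shows "irreducible_subrep (\<Sum>i\<in>UNIV. \<pi> i) (constituent \<pi>)"
  unfolding irreducible_subrep_def
proof (intro conjI allI impI)
  let ?t = "\<Sum>i\<in>UNIV. \<pi> i" and ?v = "hw_vector \<pi>"
  show "subrep ?t (constituent \<pi>)" by (rule subrep_constituent)
  have "?v \<noteq> (\<lambda>X. 0)" using hw_vector_one[of \<pi>] by auto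
  then show "constituent \<pi> \<noteq> {\<lambda>X. 0}" using hw_vector_in_constituent[of \<pi>] by auto
  fix W assume W: "subrep ?t W \<and> W \<subseteq> constituent \<pi>"
  have sW: "fs.subspace W" using W by (simp add: subrep_iff)
  have WV: "W \<subseteq> hom_polys ?t" using W constituent_subset by blast
  have vV: "?v \<in> hom_polys ?t" by (rule hw_vector_in_hom_polys)
  obtain w where w: "w \<in> W" "\<And>u. u \<in> W \<Longrightarrow> tk.ip ?t (?v - w) u = 0"
    using tk.orth_projection[OF sW WV vV] by blast
  have wV: "w \<in> hom_polys ?t" using w(1) WV by blast
  have dV: "?v - w \<in> hom_polys ?t" by (rule fs.subspace_diff[OF tk.subspace_V vV wV])
  have "semi_invariant (\<lambda>i. 2 * \<pi> i) w"
    unfolding semi_invariant_def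
  proof (intro allI impI)
    fix b :: "real^'n::_^'n::_" assume b: "invertible b \<and> upper b"
    let ?c = "\<Prod>i\<in>UNIV. (b $ i $ i) ^ (2 * \<pi> i)"
    let ?e = "gl_act b w - fscale ?c w"
    have e: "?e \<in> W"
      using W w(1) sW b by (intro fs.subspace_diff fs.subspace_scale) (auto simp: subrep_iff)
    then have eV: "?e \<in> hom_polys ?t" using WV by blast
    have bd: "gl_act b (?v - w) \<in> hom_polys ?t" "fscale ?c (?v - w) \<in> hom_polys ?t"
      using b by (auto intro: gl_act_hom_polys dV fs.subspace_scale[OF tk.subspace_V])
    have "gl_act b ?v = fscale ?c ?v"
      using semi_invariant_hw_vector[OF assms] b by (simp add: semi_invariant_def)
    then have eq: "?e = fscale ?c (?v - w) - gl_act b (?v - w)"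
      by (simp add: gl_act_linear fun_eq_iff fun_applies algebra_simps)
    have "gl_act (transpose b) ?e \<in> W"
      using W e b by (auto simp: subrep_iff transpose_invertible)
    then have "tk.ip ?t (gl_act b (?v - w)) ?e = 0"
      using b w(2) by (simp add: ip_gl_act dV eV)
    moreover have "tk.ip ?t (fscale ?c (?v - w)) ?e = 0"
      using w(2)[OF e] by (simp add: tk.ip_scale_left[OF dV eV])
    ultimately have "tk.ip ?t (fscale ?c (?v - w) - gl_act b (?v - w)) ?e = 0"
      by (subst tk.ip_diff_left[OF bd(2,1) eV]) simp
    then have "tk.ip ?t ?e ?e = 0" by (simp only: eq[symmetric])
    then have "?e = 0" by (rule tk.ip_eq_0[OF eV])
    then show "gl_act b w = fscale ?c w" by simp
  qed
  moreover have "w \<in> sym_hom_polys ?t" "?v \<in> sym_hom_polys ?t"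
    using wV vV hom_polys_subset_sym_hom_polys[of ?t] by blast+
  ultimately have w_eq: "w = fscale (w (mat 1)) ?v"
    by (rule semi_invariant_unique[OF _ _ semi_invariant_hw_vector[OF assms] _ hw_vector_one])
  show "W = {\<lambda>X. 0} \<or> W = constituent \<pi>"
  proof (cases "w (mat 1) = 0")
    case False
    have "fscale (1 / w (mat 1)) w \<in> W" by (rule fs.subspace_scale[OF sW w(1)])
    moreover have "fscale (1 / w (mat 1)) w = ?v"
      by (subst (2) w_eq) (simp add: fun_eq_iff fscale_apply False)
    ultimately have "constituent \<pi> \<subseteq> W"
      using W by (intro constituent_minimal) auto
    then show ?thesis using W by blast
  next
    case True
    then have "w = 0" using w_eq by (metis fs.scale_zero_left)
    then have orth: "tk.ip ?t ?v u = 0" if "u \<in> W" for u using w(2)[OF that] by simp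
    have "u = 0" if u: "u \<in> W" for u
    proof -
      have uV: "u \<in> hom_polys ?t" using u WV by blast
      have orth_g: "tk.ip ?t u (gl_act g ?v) = 0" if g: "invertible g" for g
      proof -
        have "gl_act (transpose g) u \<in> W" using u W g by (simp add: subrep_iff transpose_invertible)
        then have "tk.ip ?t (gl_act g ?v) u = 0" using orth g by (simp add: ip_gl_act vV uV)
        then show ?thesis using tk.ip_commute[OF uV gl_act_hom_polys[OF g vV]] by simp
      qed
      have "u \<in> constituent \<pi>" using u W by blast
      then have "tk.ip ?t u u = 0" by (rule ip_orth_constituent[rotated]) (rule orth_g)
      then show ?thesis by (rule tk.ip_eq_0[OF uV])
    qed
    then have "W = {0}" using fs.subspace_0[OF sW] by blast
    then show ?thesis by (simp add: zero_fun_def)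
  qed
qed

text \<open>
  An irreducible space with a semi-invariant of this weight contains the vector \<open>hw_vector \<pi>\<close>, because
  semi-invariants of one weight are proportional; so it contains the constituent and equals it.
\<close>

lemma zonal_space_eq:
  fixes \<pi> :: "'n::{finite,linorder} \<Rightarrow> nat"
  assumes "antimono \<pi>"
  shows "zonal_space \<pi> = constituent \<pi>"
  unfolding zonal_space_def
proof (rule the_equality)
  let ?t = "\<Sum>i\<in>UNIV. \<pi> i" and ?v = "hw_vector \<pi>"
  have "?v \<noteq> 0"
  proof
    assume "?v = 0"
    then show False using hw_vector_one[of \<pi>] by (simp add: fun_applies)
  qed
  then show "irreducible_subrep ?t (constituent \<pi>) \<and> has_highest_weight (constituent \<pi>) (\<lambda>i. 2 * \<pi> i)"
    using irreducible_constituent[OF assms] hw_vector_in_constituent semi_invariant_hw_vector[OF assms]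
    unfolding has_highest_weight_iff by blast
  fix V :: "(real^'n::_^'n::_ \<Rightarrow> real) set"
  assume V: "irreducible_subrep ?t V \<and> has_highest_weight V (\<lambda>i. 2 * \<pi> i)"
  then have sV: "subrep ?t V" by (simp add: irreducible_subrep_def)
  obtain v where v: "v \<in> V" "v \<noteq> 0" "semi_invariant (\<lambda>i. 2 * \<pi> i) v"
    using V unfolding has_highest_weight_iff by blast
  have "v \<in> sym_hom_polys ?t" "?v \<in> sym_hom_polys ?t"
    using v(1) sV hw_vector_in_hom_polys[of \<pi>] hom_polys_subset_sym_hom_polys[of ?t]
    by (auto simp: subrep_iff)
  with v(3) have v_eq: "v = fscale (v (mat 1)) ?v"
    by (rule semi_invariant_unique[OF _ _ semi_invariant_hw_vector[OF assms] _ hw_vector_one])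
  have nz: "v (mat 1) \<noteq> 0"
  proof
    assume "v (mat 1) = 0"
    then show False using v_eq v(2) by (metis fs.scale_zero_left)
  qed
  have "fscale (1 / v (mat 1)) v \<in> V"
    using sV v(1) by (auto simp: subrep_iff intro: fs.subspace_scale)
  moreover have "fscale (1 / v (mat 1)) v = ?v"
    by (subst (2) v_eq) (simp add: fun_eq_iff fscale_apply nz)
  ultimately have "constituent \<pi> \<subseteq> V" using constituent_minimal[OF sV] by simp
  moreover have "constituent \<pi> \<noteq> {\<lambda>X. 0}"
    using irreducible_constituent[OF assms] by (simp add: irreducible_subrep_def)
  ultimately show "V = constituent \<pi>"
    using V subrep_constituent[of \<pi>] unfolding irreducible_subrep_def by blast
qed

lemma polynomial_function_congruence:
  "polynomial_function (\<lambda>g :: real^'n^'n. transpose g ** Y ** g)"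
proof -
  have lin: "real_polynomial_function (\<lambda>g :: real^'n^'n. g $ i $ j)" for i j
    by (intro real_polynomial_function.intros(1)
        bounded_linear_compose[OF bounded_linear_vec_nth bounded_linear_vec_nth])
  have "real_polynomial_function (\<lambda>g :: real^'n^'n. (transpose g ** Y ** g) $ i $ j)" for i j
    unfolding matrix_matrix_mult_def transpose_def
    by (simp, intro real_polynomial_function_sum real_polynomial_function.intros(4,2) lin finite)
  then show ?thesis
    unfolding polynomial_function_iff_Basis_inner
    by (auto simp: Basis_vec_def inner_axis)
qed

text \<open>
  For \<open>g = l b\<close> with \<open>l\<close> lower and \<open>b\<close> upper triangular, moving \<open>l\<close> to the other side as its
  transpose reduces the pairing of the translate by \<open>g\<close> to the pairing of the two highest weight
  vectors, which vanishes because their weights differ on some diagonal matrix.  The pairing is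
  polynomial in \<open>g\<close>, so it vanishes for every \<open>g\<close>.
\<close>

lemma ip_hw_vector_gl_act:
  fixes \<pi> \<rho> :: "'n::{finite,linorder} \<Rightarrow> nat"
  assumes \<pi>: "antimono \<pi>" "(\<Sum>i\<in>UNIV. \<pi> i) = t" and \<rho>: "antimono \<rho>" "(\<Sum>i\<in>UNIV. \<rho> i) = t"
    and ne: "\<pi> \<noteq> \<rho>" and g: "invertible g"
  shows "tk.ip t (hw_vector \<pi>) (gl_act g (hw_vector \<rho>)) = 0"
proof -
  let ?v = "hw_vector \<pi>" and ?w = "hw_vector \<rho>"
  have V: "?v \<in> hom_polys t" "?w \<in> hom_polys t"
    using hw_vector_in_hom_polys[of \<pi>] hw_vector_in_hom_polys[of \<rho>] \<pi>(2) \<rho>(2) by auto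
  have sv: "gl_act b ?v = fscale (\<Prod>i\<in>UNIV. (b $ i $ i) ^ (2 * \<pi> i)) ?v"
    and sw: "gl_act b ?w = fscale (\<Prod>i\<in>UNIV. (b $ i $ i) ^ (2 * \<rho> i)) ?w"
    if "invertible b" "upper b" for b
    using semi_invariant_hw_vector[OF \<pi>(1)] semi_invariant_hw_vector[OF \<rho>(1)] that
    by (auto simp: semi_invariant_def)
  have vw: "tk.ip t ?v ?w = 0"
  proof -
    obtain i where i: "\<pi> i \<noteq> \<rho> i" using ne by blast
    define a :: "real^'n::_^'n::_" where "a = (\<chi> j k. if j = k then if j = i then 2 else 1 else 0)"
    have ta: "transpose a = a" by (auto simp: a_def transpose_def vec_eq_iff)
    have ua: "upper a" by (auto simp: a_def upper_def)
    have "det a = (\<Prod>j\<in>UNIV. if j = i then 2 else 1)"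
      unfolding det_upper[OF ua] by (simp add: a_def)
    then have ia: "invertible a" by (simp add: invertible_det_nz)
    have pw: "(\<Prod>j\<in>UNIV. (a $ j $ j) ^ (2 * \<sigma> j)) = 4 ^ \<sigma> i" for \<sigma> :: "'n \<Rightarrow> nat"
    proof -
      have "(\<Prod>j\<in>UNIV. (a $ j $ j) ^ (2 * \<sigma> j)) = (\<Prod>j\<in>UNIV. if j = i then 4 ^ \<sigma> i else 1)"
        by (intro prod.cong) (auto simp: a_def power_mult)
      then show ?thesis by simp
    qed
    have "4 ^ \<pi> i * tk.ip t ?v ?w = tk.ip t (gl_act a ?v) ?w"
      by (simp add: sv[OF ia ua] pw tk.ip_scale_left[OF V])
    also have "\<dots> = tk.ip t ?v (gl_act a ?w)"
      by (simp add: ip_gl_act[OF ia V] ta)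
    also have "\<dots> = 4 ^ \<rho> i * tk.ip t ?v ?w"
      by (simp add: sw[OF ia ua] pw tk.ip_scale_right)
    finally show ?thesis using i by simp
  qed
  define \<phi> where "\<phi> = (\<lambda>g. \<Sum>Y\<in>fst (tk.rep t ?v). snd (tk.rep t ?v) Y * ?w (transpose g ** Y ** g))"
  have \<phi>: "tk.ip t ?v (gl_act g ?w) = \<phi> g" for g
    by (simp add: tk.ip_def \<phi>_def gl_act_def)
  obtain q where q: "real_polynomial_function q" "\<And>X. X \<in> sym_mats \<Longrightarrow> ?w X = q X"
    using hom_polys_polynomial[OF V(2)] by blast
  have "real_polynomial_function (\<lambda>g. \<Sum>Y\<in>fst (tk.rep t ?v). snd (tk.rep t ?v) Y * q (transpose g ** Y ** g))"
  proof (intro real_polynomial_function_sum real_polynomial_function.intros(2,4) tk.rep(1) V)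
    fix Y :: "real^'n::_^'n::_"
    have "polynomial_function (\<lambda>g :: real^'n::_^'n::_. transpose g ** Y ** g)"
      by (rule polynomial_function_congruence)
    then show "real_polynomial_function (\<lambda>g. q (transpose g ** Y ** g))"
      using real_polynomial_function_compose[OF _ q(1)] by (simp add: o_def)
  qed
  moreover have "(\<lambda>g. \<Sum>Y\<in>fst (tk.rep t ?v). snd (tk.rep t ?v) Y * q (transpose g ** Y ** g)) = \<phi>"
    unfolding \<phi>_def fun_eq_iff
    using tk.rep(2)[OF V(1)] by (intro allI sum.cong refl) (auto simp: q(2) sym_congruence subset_iff)
  ultimately have poly: "real_polynomial_function \<phi>" by simp
  obtain U :: "(real^'n::_^'n::_) set" where U: "open U" "mat 1 \<in> U"
    "\<And>X. X \<in> U \<Longrightarrow> \<exists>l b. invertible l \<and> invertible b \<and> upper (transpose l) \<and> upper b \<and> X = l ** b"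
    using lower_upper_near_one by metis
  have "\<phi> h = 0" if hU: "h \<in> U" for h
  proof -
    obtain l b where lb: "invertible l" "invertible b" "upper (transpose l)" "upper b" "h = l ** b"
      using U(3)[OF hU] by blast
    let ?r = "\<Prod>i\<in>UNIV. (b $ i $ i) ^ (2 * \<rho> i)"
    let ?s = "\<Prod>i\<in>UNIV. (transpose l $ i $ i) ^ (2 * \<pi> i)"
    have "tk.ip t (gl_act h ?w) ?v = tk.ip t (gl_act l (fscale ?r ?w)) ?v"
      by (simp add: lb(5) gl_act_mult[symmetric] sw[OF lb(2,4)])
    also have "\<dots> = tk.ip t (fscale ?r ?w) (gl_act (transpose l) ?v)"
      by (rule ip_gl_act[OF lb(1) fs.subspace_scale[OF tk.subspace_V V(2)] V(1)])
    also have "\<dots> = ?r * (?s * tk.ip t ?w ?v)"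
      using sv[OF transpose_invertible[OF lb(1)] lb(3)]
      by (simp add: tk.ip_scale_left[OF V(2)] V tk.ip_scale_right fs.subspace_scale[OF tk.subspace_V])
    also have "\<dots> = 0" using vw tk.ip_commute[OF V] by simp
    finally have "tk.ip t (gl_act h ?w) ?v = 0" .
    moreover have "gl_act h ?w \<in> hom_polys t"
      using lb by (intro gl_act_hom_polys V) (simp add: invertible_mult)
    ultimately have "tk.ip t ?v (gl_act h ?w) = 0"
      using tk.ip_commute[OF V(1)] by simp
    then show ?thesis by (simp add: \<phi>)
  qed
  then have "\<phi> g = 0" using polynomial_zero_of_zero_near[OF poly U(1,2)] by blast
  then show ?thesis by (simp add: \<phi>)
qed

lemma ip_constituent_constituent:
  fixes \<pi> \<rho> :: "'n::{finite,linorder} \<Rightarrow> nat"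
  assumes \<pi>: "antimono \<pi>" "(\<Sum>i\<in>UNIV. \<pi> i) = t" and \<rho>: "antimono \<rho>" "(\<Sum>i\<in>UNIV. \<rho> i) = t"
    and ne: "\<pi> \<noteq> \<rho>" and p: "p \<in> constituent \<pi>" and q: "q \<in> constituent \<rho>"
  shows "tk.ip t p q = 0"
proof -
  have pV: "p \<in> hom_polys t" using p constituent_subset \<pi>(2) by blast
  have V: "hw_vector \<pi> \<in> hom_polys t" "hw_vector \<rho> \<in> hom_polys t"
    using hw_vector_in_hom_polys[of \<pi>] hw_vector_in_hom_polys[of \<rho>] \<pi>(2) \<rho>(2) by auto
  have "tk.ip t (gl_act g (hw_vector \<rho>)) p = 0" if g: "invertible g" for g
  proof (rule ip_orth_constituent[OF _ p])
    fix h :: "real^'n::_^'n::_" assume h: "invertible h"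
    have "tk.ip t (gl_act h (hw_vector \<pi>)) (gl_act g (hw_vector \<rho>)) =
        tk.ip t (hw_vector \<pi>) (gl_act (transpose h ** g) (hw_vector \<rho>))"
      by (simp add: ip_gl_act[OF h V(1) gl_act_hom_polys[OF g V(2)]] gl_act_mult)
    also have "\<dots> = 0"
      using g h by (intro ip_hw_vector_gl_act \<pi> \<rho> ne invertible_mult transpose_invertible)
    finally show "tk.ip t (gl_act g (hw_vector \<rho>)) (gl_act h (hw_vector \<pi>)) = 0"
      using tk.ip_commute[OF gl_act_hom_polys[OF h V(1)] gl_act_hom_polys[OF g V(2)]] by simp
  qed
  then have "tk.ip t p (gl_act g (hw_vector \<rho>)) = 0" if "invertible g" for g
    using tk.ip_commute[OF pV gl_act_hom_polys[OF that V(2)]] that by simp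
  with q show ?thesis by (rule ip_orth_constituent[rotated])
qed

section \<open>Diagonalization of symmetric matrices\<close>

lemma congruence_entry:
  fixes R Z :: "real^'n^'n"
  shows "(transpose R ** Z ** R) $ k $ l = column k R \<bullet> (Z *v column l R)"
proof -
  have "(transpose R ** Z ** R) $ k $ l = (\<Sum>m\<in>UNIV. (\<Sum>n\<in>UNIV. R $ n $ k * Z $ n $ m) * R $ m $ l)"
    by (simp add: matrix_matrix_mult_def transpose_def)
  also have "\<dots> = (\<Sum>m\<in>UNIV. \<Sum>n\<in>UNIV. R $ n $ k * (Z $ n $ m * R $ m $ l))"
    by (simp add: sum_distrib_right mult.assoc)
  also have "\<dots> = (\<Sum>n\<in>UNIV. \<Sum>m\<in>UNIV. R $ n $ k * (Z $ n $ m * R $ m $ l))"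
    by (rule sum.swap)
  also have "\<dots> = column k R \<bullet> (Z *v column l R)"
    by (simp add: inner_vec_def column_def matrix_vector_mult_def sum_distrib_left)
  finally show ?thesis .
qed

lemma inner_axis_matrix_axis:
  fixes Z :: "real^'n^'n"
  shows "axis i 1 \<bullet> (Z *v axis j 1) = Z $ i $ j"
  by (simp add: matrix_vector_mult_basis inner_axis' column_def)

lemma compact_orthogonal: "compact {Q :: real^'n^'n. orthogonal_matrix Q}"
proof -
  interpret mm: bounded_bilinear "(**) :: real^'n^'n \<Rightarrow> real^'n^'n \<Rightarrow> real^'n^'n"
    by (rule bounded_bilinear_matrix_mult)
  let ?f = "\<lambda>Q :: real^'n^'n. transpose Q ** Q"
  have "continuous_on UNIV ?f"
    by (intro mm.continuous_on continuous_intros linear_continuous_on bounded_linear_transpose)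
  then have "closed (?f -` {mat 1})" by (intro closed_vimage) auto
  moreover have "?f -` {mat 1} = {Q. orthogonal_matrix Q}"
    by (auto simp: orthogonal_matrix)
  moreover have "bounded {Q :: real^'n^'n. orthogonal_matrix Q}"
  proof (rule boundedI)
    fix Q :: "real^'n^'n" assume "Q \<in> {Q. orthogonal_matrix Q}"
    then have "trace_inner Q Q = real CARD('n)"
      by (simp add: trace_inner_def orthogonal_matrix_def trace_I)
    then show "norm Q \<le> sqrt (real CARD('n))"
      by (simp add: trace_inner_eq_inner norm_eq_sqrt_inner)
  qed
  ultimately show ?thesis by (simp add: compact_eq_bounded_closed)
qed

text \<open>
  For \<open>m \<noteq> 0\<close> the cross term, of first order in the angle, beats the quadratic one at a suitable
  small rotation.
\<close>

lemma rotation_beats_quadratic: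
  fixes D m :: real
  assumes "m \<noteq> 0"
  shows "\<exists>c s. c\<^sup>2 + s\<^sup>2 = 1 \<and> 0 < s\<^sup>2 * D + 2 * c * s * m"
proof -
  define e where "e = 1 / (1 + \<bar>D\<bar>)"
  define t where "t = e * m"
  define c where "c = 1 / sqrt (1 + t\<^sup>2)"
  have e: "e > 0" "e * D > -1"
    by (auto simp: e_def field_simps)
  have p: "1 + t\<^sup>2 > 0" by (simp add: add_pos_nonneg)
  have c2: "c\<^sup>2 = 1 / (1 + t\<^sup>2)" using p by (simp add: c_def power_divide)
  have "c\<^sup>2 + (t * c)\<^sup>2 = c\<^sup>2 * (1 + t\<^sup>2)" by algebra
  also have "\<dots> = 1" using c2 p by simp
  finally have 1: "c\<^sup>2 + (t * c)\<^sup>2 = 1" .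
  have "(t * c)\<^sup>2 * D + 2 * c * (t * c) * m = c\<^sup>2 * (m\<^sup>2 * e * (e * D + 2))"
    unfolding t_def by algebra
  moreover have "0 < c\<^sup>2 * (m\<^sup>2 * e * (e * D + 2))"
    using c2 p e assms by (intro mult_pos_pos) auto
  ultimately show ?thesis using 1 by metis
qed

text \<open>
  Maximize \<open>\<Sum>i. w i * (Q\<^sup>T X Q)\<^bsub>ii\<^esub>\<close> with distinct weights over the compact orthogonal group.  If an
  entry off the diagonal were not \<open>0\<close> at the maximum, a small rotation in the corresponding plane
  would increase the sum.
\<close>

lemma diagonalize:
  fixes X :: "real^'n^'n"
  assumes X: "X \<in> sym_mats"
  shows "\<exists>Q x. orthogonal_matrix Q \<and> transpose Q ** X ** Q = diag_mat x"
proof -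
  interpret mm: bounded_bilinear "(**) :: real^'n^'n \<Rightarrow> real^'n^'n \<Rightarrow> real^'n^'n"
    by (rule bounded_bilinear_matrix_mult)
  obtain f :: "'n \<Rightarrow> nat" where "inj f"
    using finite_imp_inj_to_nat_seg[of "UNIV :: 'n set"] by auto
  then have w: "real (f i) \<noteq> real (f j)" if "i \<noteq> j" for i j
    using that by (auto dest: injD)
  define h where "h = (\<lambda>Q :: real^'n^'n. \<Sum>k\<in>UNIV. real (f k) * (transpose Q ** X ** Q) $ k $ k)"
  have "continuous_on {Q. orthogonal_matrix Q} h"
    unfolding h_def
    by (intro continuous_intros mm.continuous_on linear_continuous_on bounded_linear_transpose)
  then obtain Q where Q: "orthogonal_matrix Q" "\<And>R. orthogonal_matrix R \<Longrightarrow> h R \<le> h Q"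
    using continuous_attains_sup[OF compact_orthogonal, of h] orthogonal_matrix_id by blast
  define Z where "Z = transpose Q ** X ** Q"
  have Zs: "Z $ j $ i = Z $ i $ j" for i j
  proof -
    have "transpose Z $ i $ j = Z $ i $ j"
      using sym_congruence[OF X, of Q] by (simp add: Z_def sym_mats_def)
    then show ?thesis by (simp add: transpose_def)
  qed
  have "Z $ i $ j = 0" if ij: "i \<noteq> j" for i j
  proof (rule ccontr)
    assume nz: "Z $ i $ j \<noteq> 0"
    define u where "u = real (f i) - real (f j)"
    have "u * Z $ i $ j \<noteq> 0" using nz w[OF ij] by (simp add: u_def)
    then obtain c s where cs: "c\<^sup>2 + s\<^sup>2 = 1"
      "0 < s\<^sup>2 * (u * (Z $ j $ j - Z $ i $ i)) + 2 * c * s * (u * Z $ i $ j)"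
      using rotation_beats_quadratic by blast
    define col :: "'n \<Rightarrow> real^'n" where "col = (\<lambda>k. if k = i then c *\<^sub>R axis i 1 + s *\<^sub>R axis j 1
        else if k = j then (- s) *\<^sub>R axis i 1 + c *\<^sub>R axis j 1 else axis k 1)"
    define R :: "real^'n^'n" where "R = (\<chi> m k. col k $ m)"
    have colR: "column k R = col k" for k by (simp add: column_def R_def vec_eq_iff)
    have "(transpose R ** mat 1 ** R) $ k $ l = mat 1 $ k $ l" for k l
      unfolding congruence_entry colR matrix_vector_mul_lid
      using cs(1) ij
      by (auto simp: col_def inner_add_left inner_add_right inner_diff_left inner_diff_right
          inner_axis_axis mat_def power2_eq_square algebra_simps)
    then have "transpose R ** R = mat 1" by (simp add: vec_eq_iff)
    then have R: "orthogonal_matrix R" by (simp add: orthogonal_matrix)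
    have E: "(transpose R ** Z ** R) $ k $ k = col k \<bullet> (Z *v col k)" for k
      by (simp add: congruence_entry colR)
    have Ei: "(transpose R ** Z ** R) $ i $ i =
        c\<^sup>2 * Z $ i $ i + 2 * c * s * Z $ i $ j + s\<^sup>2 * Z $ j $ j"
      unfolding E
      by (simp add: col_def matrix_vector_right_distrib matrix_vector_mult_scaleR inner_add_left inner_add_right
          inner_axis_matrix_axis Zs power2_eq_square algebra_simps)
    have Ej: "(transpose R ** Z ** R) $ j $ j =
        s\<^sup>2 * Z $ i $ i - 2 * c * s * Z $ i $ j + c\<^sup>2 * Z $ j $ j"
      unfolding E using ij
      by (simp add: col_def matrix_vector_right_distrib matrix_vector_mult_scaleR inner_add_left inner_add_right
          matrix_vector_mult_diff_distrib inner_diff_left inner_diff_right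
          inner_axis_matrix_axis Zs power2_eq_square algebra_simps)
    have Ek: "(transpose R ** Z ** R) $ k $ k = Z $ k $ k" if "k \<noteq> i" "k \<noteq> j" for k
      unfolding E using that by (simp add: col_def inner_axis_matrix_axis)
    have "transpose (Q ** R) ** X ** (Q ** R) = transpose R ** Z ** R"
      by (simp add: Z_def matrix_transpose_mul matrix_mul_assoc)
    then have "h (Q ** R) - h Q =
        (\<Sum>k\<in>UNIV. real (f k) * ((transpose R ** Z ** R) $ k $ k - Z $ k $ k))"
      by (simp add: h_def Z_def sum_subtractf right_diff_distrib)
    also have "\<dots> = (\<Sum>k\<in>{i, j}. real (f k) * ((transpose R ** Z ** R) $ k $ k - Z $ k $ k))"
      by (rule sum.mono_neutral_right) (auto simp: Ek)
    also have "\<dots> = s\<^sup>2 * (u * (Z $ j $ j - Z $ i $ i)) + 2 * c * s * (u * Z $ i $ j)"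
    proof -
      have c2: "c\<^sup>2 = 1 - s\<^sup>2" using cs(1) by simp
      have "(\<Sum>k\<in>{i, j}. real (f k) * ((transpose R ** Z ** R) $ k $ k - Z $ k $ k)) =
          real (f i) * ((transpose R ** Z ** R) $ i $ i - Z $ i $ i) +
          real (f j) * ((transpose R ** Z ** R) $ j $ j - Z $ j $ j)"
        using ij by simp
      also have "\<dots> = s\<^sup>2 * (u * (Z $ j $ j - Z $ i $ i)) + 2 * c * s * (u * Z $ i $ j)"
        unfolding Ei Ej u_def c2 by (simp add: algebra_simps)
      finally show ?thesis .
    qed
    also have "\<dots> > 0" by (rule cs(2))
    finally have "h Q < h (Q ** R)" by simp
    moreover have "h (Q ** R) \<le> h Q" by (intro Q(2) orthogonal_matrix_mul Q(1) R)
    ultimately show False by simp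
  qed
  then have "Z = diag_mat (\<chi> i. Z $ i $ i)"
    by (auto simp: diag_mat_def vec_eq_iff)
  then show ?thesis using Q(1) unfolding Z_def by blast
qed

section \<open>Symmetric polynomials in the eigenvalues\<close>

definition words :: "nat \<Rightarrow> 'n list set" where
  "words t = {l. length l = t}"

text \<open>
  Monomials are indexed by words and not by exponents, since the power of a sum then expands with all
  coefficients equal to \<open>1\<close>.  Words that differ by a permutation give the same monomial.
\<close>

definition word_monom :: "'n list \<Rightarrow> real^'n \<Rightarrow> real" where
  "word_monom l x = prod_list (map (\<lambda>i. x $ i) l)"

lemma power_sum_words:
  fixes a x :: "real^'n"
  shows "(\<Sum>i\<in>UNIV. a $ i * x $ i) ^ t = (\<Sum>l\<in>words t. word_monom l a * word_monom l x)"
proof (induction t)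
  case 0
  then show ?case by (simp add: words_def word_monom_def)
next
  case (Suc t)
  have eq: "words (Suc t) = (\<lambda>(i, l). i # l) ` (UNIV \<times> words t :: ('n \<times> 'n list) set)"
    by (auto simp: words_def length_Suc_conv)
  have "(\<Sum>l\<in>words (Suc t). word_monom l a * word_monom l x) =
      (\<Sum>(i, l)\<in>UNIV \<times> words t. (a $ i * x $ i) * (word_monom l a * word_monom l x))"
    unfolding eq
    by (subst sum.reindex) (auto simp: inj_on_def word_monom_def mult_ac intro!: sum.cong)
  also have "\<dots> = (\<Sum>i\<in>UNIV. a $ i * x $ i) * (\<Sum>l\<in>words t. word_monom l a * word_monom l x)"
    by (simp add: sum.cartesian_product[symmetric] sum_product)
  finally show ?case using Suc by simp
qed

lemma word_monom_eq_prod_power: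
  fixes x :: "real^'n"
  shows "word_monom l x = (\<Prod>i\<in>UNIV. (x $ i) ^ count_list l i)"
proof (induction l)
  case (Cons j l)
  have "(\<Prod>i\<in>UNIV. (x $ i) ^ count_list (j # l) i) =
      (\<Prod>i\<in>UNIV. (if i = j then x $ i else 1) * (x $ i) ^ count_list l i)"
    by (intro prod.cong) auto
  also have "\<dots> = x $ j * word_monom l x"
    by (simp add: prod.distrib Cons.IH)
  finally show ?case by (simp add: word_monom_def)
qed (simp add: word_monom_def)

lemma sum_count_list: "(\<Sum>i\<in>(UNIV :: 'n::finite set). count_list l i) = length l"
  by (rule sum_count_set) auto

definition sym_monom :: "('n \<Rightarrow> nat) \<Rightarrow> real^'n \<Rightarrow> real" where
  "sym_monom e x = (\<Sum>p\<in>{p. p permutes UNIV}. \<Prod>i\<in>UNIV. (x $ p i) ^ e i)"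

lemma sym_monom_permute:
  fixes e :: "'n::finite \<Rightarrow> nat"
  assumes q: "q permutes UNIV"
  shows "sym_monom (e \<circ> q) = sym_monom e"
proof
  fix x :: "real^'n"
  have "sym_monom e x = (\<Sum>p\<in>{p. p permutes UNIV}. \<Prod>i\<in>UNIV. (x $ p i) ^ e i)"
    by (simp add: sym_monom_def)
  also have "\<dots> = (\<Sum>p\<in>{p. p permutes UNIV}. \<Prod>i\<in>UNIV. (x $ p (q i)) ^ e (q i))"
    by (intro sum.cong refl) (rule prod.permute[OF q, unfolded o_def])
  also have "\<dots> = (\<Sum>p\<in>{p. p permutes UNIV}. \<Prod>i\<in>UNIV. (x $ (p \<circ> q) i) ^ (e \<circ> q) i)"
    by simp
  also have "\<dots> = sym_monom (e \<circ> q) x"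
    unfolding sym_monom_def by (rule sum_permutations_compose_right[OF q, symmetric])
  finally show "sym_monom (e \<circ> q) x = sym_monom e x" by simp
qed

text \<open>
  A permutation that maximizes the sum of \<open>e (p i)\<close> weighted by strictly decreasing weights sorts
  \<open>e\<close>, since exchanging the values at two indices in the wrong order would increase the sum.
\<close>

lemma exists_sorting_permutation:
  fixes e :: "'n::{finite,linorder} \<Rightarrow> nat"
  shows "\<exists>q. q permutes UNIV \<and> antimono (e \<circ> q)"
proof -
  define r :: "'n \<Rightarrow> int" where "r = (\<lambda>i. int (card {j. i < j}))"
  have r: "r j < r i" if "i < j" for i j
    unfolding r_def using that by (simp, intro psubset_card_mono) auto
  define S where "S = (\<lambda>q :: 'n \<Rightarrow> 'n. \<Sum>i\<in>UNIV. r i * int (e (q i)))"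
  let ?P = "{q :: 'n \<Rightarrow> 'n. q permutes UNIV}"
  have fin: "finite (S ` ?P)" by (simp add: finite_permutations)
  have "S ` ?P \<noteq> {}" using permutes_id by blast
  from Max_in[OF fin this] obtain q where q: "q permutes UNIV" "S q = Max (S ` ?P)" by auto
  have max: "S p \<le> S q" if "p permutes UNIV" for p
    using q(2) Max_ge[OF fin] that by auto
  have "e (q j) \<le> e (q i)" if ij: "i < j" for i j
  proof (rule ccontr)
    assume bad: "\<not> e (q j) \<le> e (q i)"
    define p where "p = q \<circ> Transposition.transpose i j"
    have p: "p permutes UNIV" unfolding p_def by (intro permutes_compose permutes_swap_id q) auto
    have "S p - S q = (\<Sum>k\<in>UNIV. r k * (int (e (p k)) - int (e (q k))))"
      by (simp add: S_def sum_subtractf right_diff_distrib)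
    also have "\<dots> = (\<Sum>k\<in>{i, j}. r k * (int (e (p k)) - int (e (q k))))"
      by (rule sum.mono_neutral_right) (auto simp: p_def Transposition.transpose_def)
    also have "\<dots> = (r i - r j) * (int (e (q j)) - int (e (q i)))"
      using ij by (simp add: p_def algebra_simps)
    also have "\<dots> > 0" using r[OF ij] bad by simp
    finally show False using max[OF p] by simp
  qed
  then have "antimono (e \<circ> q)"
    by (intro antimonoI) (metis comp_apply le_less order_refl)
  then show ?thesis using q(1) by blast
qed

lemma sym_monom_in_partitions:
  fixes e :: "'n::{finite,linorder} \<Rightarrow> nat"
  assumes "(\<Sum>i\<in>UNIV. e i) = t"
  shows "sym_monom e \<in> sym_monom ` partitions_upto t"
proof -
  obtain q where q: "q permutes UNIV" "antimono (e \<circ> q)"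
    using exists_sorting_permutation by blast
  have "(\<Sum>i\<in>UNIV. (e \<circ> q) i) = t"
    using sum.permute[OF q(1), of e] assms by simp
  then have "e \<circ> q \<in> partitions_upto t" using q(2) by (simp add: partitions_upto_def)
  then show ?thesis using sym_monom_permute[OF q(1), of e] by (metis imageI)
qed

lemma finite_partitions_upto: "finite (partitions_upto t :: ('n::{finite,linorder} \<Rightarrow> nat) set)"
proof (rule finite_subset)
  show "partitions_upto t \<subseteq> (UNIV :: 'n set) \<rightarrow>\<^sub>E {..t}"
    using sum_fun_nat_le by (auto simp: partitions_upto_def)
qed (auto intro: finite_PiE)

text \<open>Averaging over permutations turns monomials into symmetric monomials.\<close>

lemma symmetric_in_span_sym_monom:
  fixes h :: "real^'n::{finite,linorder} \<Rightarrow> real"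
  assumes h: "h \<in> fs.span (word_monom ` words t)"
    and sym: "\<And>p x. p permutes UNIV \<Longrightarrow> h (\<chi> i. x $ p i) = h x"
  shows "h \<in> fs.span (sym_monom ` partitions_upto t)"
proof -
  let ?P = "{p :: 'n \<Rightarrow> 'n. p permutes UNIV}"
  define A where "A = (\<lambda>(f :: real^'n::_ \<Rightarrow> real) x. \<Sum>p\<in>?P. f (\<chi> i. x $ p i))"
  have "A f \<in> fs.span (sym_monom ` partitions_upto t)" if "f \<in> fs.span (word_monom ` words t)" for f
    using that
  proof (induction rule: fs.span_induct_alt)
    case base
    have "A 0 = 0" by (simp add: A_def fun_eq_iff fun_applies)
    then show ?case by (simp add: fs.span_zero)
  next
    case (step c k f)
    then obtain l where l: "k = word_monom l" "length l = t" by (auto simp: words_def)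
    have "A k = sym_monom (count_list l)"
      by (simp add: A_def fun_eq_iff l(1) word_monom_eq_prod_power sym_monom_def)
    moreover have "A (fscale c k + f) = fscale c (A k) + A f"
      by (simp add: A_def fun_eq_iff fun_applies sum.distrib sum_distrib_left)
    ultimately show ?case
      using step.IH sym_monom_in_partitions[of "count_list l" t] l(2)
      by (simp add: fs.span_add fs.span_scale fs.span_base sum_count_list)
  qed
  from this[OF h] have "fscale (1 / real (card ?P)) (A h) \<in> fs.span (sym_monom ` partitions_upto t)"
    by (rule fs.span_scale)
  moreover have "fscale (1 / real (card ?P)) (A h) = h"
  proof
    fix x
    have "?P \<noteq> {}" using permutes_id by blast
    then have "card ?P \<noteq> 0" by (simp add: finite_permutations)
    then show "fscale (1 / real (card ?P)) (A h) x = h x"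
      by (simp add: A_def sym fscale_apply)
  qed
  ultimately show ?thesis by simp
qed

section \<open>The zonal polynomials\<close>

text \<open>
  The orthogonal projection of the trace power onto the constituent.  Since the trace power is the
  kernel function at the identity, this is the element that represents evaluation at the
  identity on the constituent.
\<close>

definition zonal_component :: "('n::{finite,linorder} \<Rightarrow> nat) \<Rightarrow> real^'n::_^'n::_ \<Rightarrow> real" where
  "zonal_component \<pi> = (SOME c. c \<in> constituent \<pi> \<and>
     (\<forall>u\<in>constituent \<pi>. tk.ip (\<Sum>i\<in>UNIV. \<pi> i) (pow_kernel (\<Sum>i\<in>UNIV. \<pi> i) (mat 1) - c) u = 0))"

lemma one_in_sym_mats: "mat 1 \<in> sym_mats"
  by (simp add: sym_mats_def)

lemma trace_power_eq_pow_kernel: "X \<in> sym_mats \<Longrightarrow> pow_kernel t (mat 1) X = trace X ^ t"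
  by (simp add: pow_kernel_def trace_inner_eq_inner[symmetric] trace_inner_def sym_mats_def)

lemma zonal_component:
  fixes \<pi> :: "'n::{finite,linorder} \<Rightarrow> nat"
  assumes t: "(\<Sum>i\<in>UNIV. \<pi> i) = t"
  shows "zonal_component \<pi> \<in> constituent \<pi>"
    and "zonal_component \<pi> \<in> hom_polys t"
    and "u \<in> constituent \<pi> \<Longrightarrow> tk.ip t (zonal_component \<pi>) u = u (mat 1)"
proof -
  let ?K = "pow_kernel t (mat 1) :: real^'n::_^'n::_ \<Rightarrow> real"
  have K: "?K \<in> hom_polys t" by (rule tk.k_in_V[OF one_in_sym_mats])
  have C: "constituent \<pi> \<subseteq> hom_polys t" using constituent_subset[of \<pi>] t by simp
  have "\<exists>c. c \<in> constituent \<pi> \<and> (\<forall>u\<in>constituent \<pi>. tk.ip t (?K - c) u = 0)"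
    using tk.orth_projection[OF subspace_constituent C K] by blast
  from someI_ex[OF this] have z: "zonal_component \<pi> \<in> constituent \<pi>"
    "\<forall>u\<in>constituent \<pi>. tk.ip t (?K - zonal_component \<pi>) u = 0"
    unfolding zonal_component_def t by auto
  show "zonal_component \<pi> \<in> constituent \<pi>" by (rule z(1))
  show zV: "zonal_component \<pi> \<in> hom_polys t" using z(1) C by blast
  show "tk.ip t (zonal_component \<pi>) u = u (mat 1)" if u: "u \<in> constituent \<pi>"
  proof -
    have uV: "u \<in> hom_polys t" using u C by blast
    have "tk.ip t (?K - zonal_component \<pi>) u = u (mat 1) - tk.ip t (zonal_component \<pi>) u"
      by (simp add: tk.ip_diff_left[OF K zV uV] tk.ip_kernel[OF one_in_sym_mats uV])
    then show ?thesis using z(2) u by simp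
  qed
qed

lemma orthogonal_imp_invertible: "orthogonal_matrix (Q :: real^'n^'n) \<Longrightarrow> invertible Q"
  unfolding orthogonal_matrix_def invertible_def by blast

text \<open>
  Equality is asked at symmetric arguments, because these are the matrices that orthogonal
  conjugation makes diagonal.
\<close>

definition conj_invariant :: "(real^'n^'n \<Rightarrow> real) \<Rightarrow> bool" where
  "conj_invariant f \<longleftrightarrow>
     (\<forall>Q X. orthogonal_matrix Q \<longrightarrow> X \<in> sym_mats \<longrightarrow> f (transpose Q ** X ** Q) = f X)"

text \<open>
  The conjugate by \<open>Q\<close> lies in the same constituent and represents evaluation at the identity as well,
  since \<open>Q Q\<^sup>T\<close> is the identity.
\<close>

lemma conj_invariant_zonal_component:
  fixes \<pi> :: "'n::{finite,linorder} \<Rightarrow> nat"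
  shows "conj_invariant (zonal_component \<pi>)"
  unfolding conj_invariant_def
proof (intro allI impI)
  fix Q X :: "real^'n::_^'n::_" assume Q: "orthogonal_matrix Q"
  define t where "t = (\<Sum>i\<in>UNIV. \<pi> i)"
  have t: "(\<Sum>i\<in>UNIV. \<pi> i) = t" by (simp add: t_def)
  let ?z = "zonal_component \<pi>"
  note z = zonal_component[OF t]
  have iQ: "invertible Q" by (rule orthogonal_imp_invertible[OF Q])
  let ?e = "gl_act Q ?z - ?z"
  have gz: "gl_act Q ?z \<in> constituent \<pi>" by (rule gl_act_constituent[OF iQ z(1)])
  have e: "?e \<in> constituent \<pi>" by (rule fs.subspace_diff[OF subspace_constituent gz z(1)])
  have V: "gl_act Q ?z \<in> hom_polys t" "?e \<in> hom_polys t"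
    using gz e constituent_subset[of \<pi>] t by auto
  have "tk.ip t (gl_act Q ?z) ?e = tk.ip t ?z (gl_act (transpose Q) ?e)"
    by (rule ip_gl_act[OF iQ z(2) V(2)])
  also have "\<dots> = gl_act (transpose Q) ?e (mat 1)"
    by (intro z(3) gl_act_constituent transpose_invertible iQ e)
  also have "\<dots> = ?e (mat 1)"
    using Q by (simp add: gl_act_def orthogonal_matrix_def)
  also have "\<dots> = tk.ip t ?z ?e" by (rule z(3)[OF e, symmetric])
  finally have "tk.ip t ?e ?e = 0"
    by (subst tk.ip_diff_left[OF V(1) z(2) V(2)]) simp
  then have "?e = 0" by (rule tk.ip_eq_0[OF V(2)])
  then have "gl_act Q ?z = ?z" by simp
  then show "?z (transpose Q ** X ** Q) = ?z X"
    unfolding gl_act_def by (rule fun_cong)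
qed

text \<open>
  The value is the squared length of the component.  It is not \<open>0\<close> because the highest weight vector
  has the value \<open>1\<close> at the identity.
\<close>

lemma zonal_component_one_pos:
  fixes \<pi> :: "'n::{finite,linorder} \<Rightarrow> nat"
  shows "0 < zonal_component \<pi> (mat 1)"
proof -
  define t where "t = (\<Sum>i\<in>UNIV. \<pi> i)"
  note z = zonal_component[of \<pi> t, unfolded t_def, OF refl]
  have eq: "tk.ip (\<Sum>i\<in>UNIV. \<pi> i) (zonal_component \<pi>) (zonal_component \<pi>) = zonal_component \<pi> (mat 1)"
    by (rule z(3)[OF z(1)])
  have "zonal_component \<pi> (mat 1) \<noteq> 0"
  proof
    assume "zonal_component \<pi> (mat 1) = 0"
    then have z0: "zonal_component \<pi> = 0" using eq by (intro tk.ip_eq_0[OF z(2)]) simp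
    have "tk.ip (\<Sum>i\<in>UNIV. \<pi> i) (zonal_component \<pi>) (hw_vector \<pi>) = 1"
      using z(3)[OF hw_vector_in_constituent] by (simp add: hw_vector_one)
    moreover have "tk.ip (\<Sum>i\<in>UNIV. \<pi> i) (hw_vector \<pi>) (zonal_component \<pi>) = 0"
      by (simp add: z0)
    ultimately show False
      using tk.ip_commute[OF z(2) hw_vector_in_hom_polys] by simp
  qed
  then show ?thesis using eq tk.ip_nonneg[OF z(2)] by simp
qed

lemma ip_zonal_components:
  fixes \<pi> \<rho> :: "'n::{finite,linorder} \<Rightarrow> nat"
  assumes "\<pi> \<in> partitions_upto t" "\<rho> \<in> partitions_upto t"
  shows "tk.ip t (zonal_component \<rho>) (zonal_component \<pi>) =
    (if \<pi> = \<rho> then zonal_component \<rho> (mat 1) else 0)"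
proof -
  have \<pi>: "antimono \<pi>" "(\<Sum>i\<in>UNIV. \<pi> i) = t" and \<rho>: "antimono \<rho>" "(\<Sum>i\<in>UNIV. \<rho> i) = t"
    using assms by (auto simp: partitions_upto_def)
  show ?thesis
    using ip_constituent_constituent[OF \<rho> \<pi> _ zonal_component(1)[OF \<rho>(2)] zonal_component(1)[OF \<pi>(2)]]
      zonal_component(3)[OF \<rho>(2) zonal_component(1)[OF \<rho>(2)]] by auto
qed

lemma diag_mat_in_sym_mats: "diag_mat x \<in> sym_mats"
  by (auto simp: diag_mat_def sym_mats_def transpose_def vec_eq_iff)

lemma conj_invariant_eqI:
  fixes f g :: "real^'n^'n \<Rightarrow> real"
  assumes "conj_invariant f" "conj_invariant g" "\<And>x. f (diag_mat x) = g (diag_mat x)"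
    and X: "X \<in> sym_mats"
  shows "f X = g X"
proof -
  obtain Q x where Q: "orthogonal_matrix Q" "transpose Q ** X ** Q = diag_mat x"
    using diagonalize[OF X] by blast
  then show ?thesis using assms unfolding conj_invariant_def by metis
qed

text \<open>
  Permutation matrices are orthogonal, so an invariant function is symmetric in the diagonal entries.
\<close>

lemma conj_invariant_permute:
  fixes f :: "real^'n^'n \<Rightarrow> real"
  assumes f: "conj_invariant f" and p: "p permutes UNIV"
  shows "f (diag_mat (\<chi> i. x $ p i)) = f (diag_mat x)"
proof -
  define Q :: "real^'n^'n" where "Q = (\<chi> i j. if i = p j then 1 else 0)"
  have col: "column k Q = axis (p k) 1" for k
    by (simp add: column_def Q_def axis_def vec_eq_iff)
  have inj: "p k = p l \<longleftrightarrow> k = l" for k l using permutes_inj[OF p] by (auto dest: injD)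
  have "transpose Q ** mat 1 ** Q = mat 1"
    unfolding vec_eq_iff congruence_entry col inner_axis_matrix_axis by (simp add: mat_def inj)
  then have "orthogonal_matrix Q" by (simp add: orthogonal_matrix)
  moreover have "transpose Q ** diag_mat x ** Q = diag_mat (\<chi> i. x $ p i)"
    unfolding vec_eq_iff congruence_entry col inner_axis_matrix_axis by (simp add: diag_mat_def inj)
  ultimately show ?thesis
    using f diag_mat_in_sym_mats unfolding conj_invariant_def by metis
qed

lemma inner_diag_mat: "Y \<bullet> diag_mat x = (\<Sum>i\<in>UNIV. (\<chi> i. Y $ i $ i) $ i * x $ i)"
  by (simp add: inner_vec_def diag_mat_def if_distrib[of "\<lambda>z. _ * z"] cong: if_cong)

lemma hom_polys_diag_mat:
  fixes f :: "real^'n^'n \<Rightarrow> real"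
  assumes "f \<in> hom_polys t"
  shows "(\<lambda>x. f (diag_mat x)) \<in> fs.span (word_monom ` words t)"
proof -
  have "f \<in> fs.span (pow_kernel t ` sym_mats)"
    using assms by (simp only: tk.V_def)
  then show ?thesis
  proof (induction rule: fs.span_induct_alt)
    case base
    have "(\<lambda>x. 0 (diag_mat x)) = (0 :: real^'n \<Rightarrow> real)" by (simp add: fun_eq_iff fun_applies)
    then show ?case by (simp only: fs.span_zero)
  next
    case (step c k f)
    then obtain Y where Y: "k = pow_kernel t Y" by blast
    let ?a = "\<chi> i. Y $ i $ i"
    have eq: "(\<lambda>x. (fscale c k + f) (diag_mat x)) =
        fscale c (\<Sum>l\<in>words t. fscale (word_monom l ?a) (word_monom l)) + (\<lambda>x. f (diag_mat x))"
      by (simp add: fun_eq_iff fun_applies Y pow_kernel_def diag_mat_in_sym_mats inner_diag_mat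
          power_sum_words[of ?a, simplified])
    show ?case
      unfolding eq using step.IH
      by (intro fs.span_add fs.span_scale fs.span_sum) (auto intro: fs.span_base)
  qed
qed

text \<open>
  Invariant functions are determined by their values on diagonal matrices, where they are combinations
  of symmetric monomials.  There are as many of these as there are partitions, and the components of
  the trace power, being orthogonal, are equally many independent invariant functions.
\<close>

lemma conj_invariant_in_span:
  fixes f :: "real^'n::{finite,linorder}^'n::_ \<Rightarrow> real"
  assumes f: "conj_invariant f" and fd: "(\<lambda>x. f (diag_mat x)) \<in> fs.span (word_monom ` words t)"
  shows "\<exists>a. \<forall>X\<in>sym_mats. f X = (\<Sum>\<pi>\<in>partitions_upto t. a \<pi> * zonal_component \<pi> X)"
proof -
  let ?P = "partitions_upto t :: ('n \<Rightarrow> nat) set"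
  define d where "d = (\<lambda>\<pi> :: 'n \<Rightarrow> nat. \<lambda>x. zonal_component \<pi> (diag_mat x))"
  let ?B = "sym_monom ` ?P"
  note finP = finite_partitions_upto[where 'n = 'n, of t]
  have zV: "zonal_component \<pi> \<in> hom_polys t" if "\<pi> \<in> ?P" for \<pi>
    using that zonal_component(2)[of \<pi> t] by (simp add: partitions_upto_def)
  have inv: "conj_invariant (\<lambda>X. \<Sum>\<pi>\<in>?P. a \<pi> * zonal_component \<pi> X)" for a
    using conj_invariant_zonal_component[where 'n = 'n] unfolding conj_invariant_def by simp
  have coeff0: "a \<rho> = 0"
    if z: "(\<Sum>\<pi>\<in>?P. fscale (a \<pi>) (d \<pi>)) = 0" and \<rho>: "\<rho> \<in> ?P" for a \<rho>
  proof -
    let ?F = "\<Sum>\<pi>\<in>?P. fscale (a \<pi>) (zonal_component \<pi>)"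
    have V: "fscale (a \<pi>) (zonal_component \<pi>) \<in> hom_polys t" if "\<pi> \<in> ?P" for \<pi>
      by (rule fs.subspace_scale[OF tk.subspace_V zV[OF that]])
    have FV: "?F \<in> hom_polys t" by (rule fs.subspace_sum[OF tk.subspace_V V])
    have "?F X = 0" for X
    proof (cases "X \<in> sym_mats")
      case True
      have "(\<Sum>\<pi>\<in>?P. a \<pi> * zonal_component \<pi> (diag_mat x)) = 0" for x
        using fun_cong[OF z, of x] by (simp add: fun_applies d_def)
      then have "(\<Sum>\<pi>\<in>?P. a \<pi> * zonal_component \<pi> X) = 0"
        using conj_invariant_eqI[OF inv[of a] _ _ True, of "\<lambda>_. 0"] by (simp add: conj_invariant_def)
      then show ?thesis by (simp add: fun_applies)
    qed (use tk.V_off[OF FV] in simp)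
    then have "?F = 0" by (simp add: fun_eq_iff fun_applies)
    then have "0 = tk.ip t (zonal_component \<rho>) ?F" by simp
    also have "\<dots> = (\<Sum>\<pi>\<in>?P. a \<pi> * (if \<pi> = \<rho> then zonal_component \<rho> (mat 1) else 0))"
      unfolding tk.ip_sum_right tk.ip_scale_right
      by (intro sum.cong refl) (simp add: ip_zonal_components[OF _ \<rho>])
    also have "\<dots> = a \<rho> * zonal_component \<rho> (mat 1)"
      using \<rho> finP by (simp add: if_distrib[of "\<lambda>z. _ * z"] cong: if_cong)
    finally show ?thesis using zonal_component_one_pos[of \<rho>] by simp
  qed
  have inj: "inj_on d ?P"
  proof (rule inj_onI, rule ccontr)
    fix \<pi> \<rho> assume h: "\<pi> \<in> ?P" "\<rho> \<in> ?P" "d \<pi> = d \<rho>" "\<pi> \<noteq> \<rho>"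
    let ?a = "\<lambda>\<sigma>. if \<sigma> = \<pi> then 1 else if \<sigma> = \<rho> then - 1 else 0 :: real"
    have "(\<Sum>\<sigma>\<in>?P. fscale (?a \<sigma>) (d \<sigma>)) = (\<Sum>\<sigma>\<in>{\<pi>, \<rho>}. fscale (?a \<sigma>) (d \<sigma>))"
      using h finP by (intro sum.mono_neutral_right) (auto simp: fun_eq_iff fun_applies)
    also have "\<dots> = fscale 1 (d \<pi>) + fscale (- 1) (d \<rho>)" using h(4) by auto
    also have "\<dots> = 0" unfolding h(3) by (simp add: fun_eq_iff fun_applies)
    finally show False using coeff0[of ?a \<pi>] h(1) by simp
  qed
  have ind: "fs.independent (d ` ?P)"
  proof (rule fs.independent_if_scalars_zero)
    show "finite (d ` ?P)" using finP by simp
    fix a g assume s: "(\<Sum>g\<in>d ` ?P. fscale (a g) g) = 0" and g: "g \<in> d ` ?P"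
    obtain \<pi> where \<pi>: "\<pi> \<in> ?P" "g = d \<pi>" using g by blast
    have "(\<Sum>\<pi>\<in>?P. fscale (a (d \<pi>)) (d \<pi>)) = 0"
      using s by (simp add: sum.reindex[OF inj])
    from coeff0[OF this \<pi>(1)] show "a g = 0" by (simp add: \<pi>(2))
  qed
  have "d \<pi> \<in> fs.span ?B" if "\<pi> \<in> ?P" for \<pi>
    unfolding d_def
    by (intro symmetric_in_span_sym_monom hom_polys_diag_mat zV that
        conj_invariant_permute conj_invariant_zonal_component)
  then have sub: "d ` ?P \<subseteq> fs.span ?B" by blast
  have "card ?B \<le> card (d ` ?P)"
    using card_image_le[OF finP, of sym_monom] by (simp add: card_image[OF inj])
  then have "fs.span ?B \<subseteq> fs.span (d ` ?P)"
    by (intro span_eq_of_card_le ind sub) (simp add: finP)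
  moreover have "(\<lambda>x. f (diag_mat x)) \<in> fs.span ?B"
    by (intro symmetric_in_span_sym_monom fd conj_invariant_permute f)
  ultimately have "(\<lambda>x. f (diag_mat x)) \<in> fs.span (d ` ?P)" by blast
  then obtain a0 where "(\<lambda>x. f (diag_mat x)) = (\<Sum>g\<in>d ` ?P. fscale (a0 g) g)"
    using fs.span_finite[of "d ` ?P"] finP by auto
  then have a0: "(\<lambda>x. f (diag_mat x)) = (\<Sum>\<pi>\<in>?P. fscale (a0 (d \<pi>)) (d \<pi>))"
    by (simp add: sum.reindex[OF inj])
  have "f (diag_mat x) = (\<Sum>\<pi>\<in>?P. a0 (d \<pi>) * zonal_component \<pi> (diag_mat x))" for x
    using fun_cong[OF a0, of x] by (simp add: fun_applies d_def)
  from conj_invariant_eqI[OF f inv[of "\<lambda>\<pi>. a0 (d \<pi>)"] this] show ?thesis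
    by (intro exI[of _ "\<lambda>\<pi>. a0 (d \<pi>)"] ballI)
qed

lemma conj_invariant_trace_power: "conj_invariant (pow_kernel t (mat 1))"
  unfolding conj_invariant_def
proof (intro allI impI)
  fix Q X :: "real^'n^'n" assume h: "orthogonal_matrix Q" "X \<in> sym_mats"
  have "gl_act Q (pow_kernel t (mat 1)) = pow_kernel t (mat 1)"
    using h(1) by (simp add: gl_act_pow_kernel orthogonal_imp_invertible orthogonal_matrix_def)
  then show "pow_kernel t (mat 1) (transpose Q ** X ** Q) = pow_kernel t (mat 1) X"
    unfolding gl_act_def by (rule fun_cong)
qed

text \<open>
  The trace power is invariant, hence a combination of the components; pairing with one of them
  shows that its coefficient is \<open>1\<close>.
\<close>

lemma pow_kernel_one_eq_sum:
  "pow_kernel t (mat 1) = (\<Sum>\<pi>\<in>partitions_upto t. zonal_component (\<pi> :: 'n::{finite,linorder} \<Rightarrow> nat))"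
proof -
  let ?P = "partitions_upto t :: ('n \<Rightarrow> nat) set"
  let ?K = "pow_kernel t (mat 1) :: real^'n::_^'n::_ \<Rightarrow> real"
  note finP = finite_partitions_upto[where 'n = 'n, of t]
  have K: "?K \<in> hom_polys t" by (rule tk.k_in_V[OF one_in_sym_mats])
  obtain a where a: "\<And>X. X \<in> sym_mats \<Longrightarrow> ?K X = (\<Sum>\<pi>\<in>?P. a \<pi> * zonal_component \<pi> X)"
    using conj_invariant_in_span[OF conj_invariant_trace_power hom_polys_diag_mat[OF K]] by blast
  have zV: "zonal_component \<pi> \<in> hom_polys t" if "\<pi> \<in> ?P" for \<pi>
    using that zonal_component(2)[of \<pi> t] by (simp add: partitions_upto_def)
  have K_eq: "?K = (\<Sum>\<pi>\<in>?P. fscale (a \<pi>) (zonal_component \<pi>))"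
  proof
    fix X show "?K X = (\<Sum>\<pi>\<in>?P. fscale (a \<pi>) (zonal_component \<pi>)) X"
    proof (cases "X \<in> sym_mats")
      case False
      then show ?thesis
        using tk.V_off[OF K False] tk.V_off[OF zV False] by (simp add: fun_applies)
    qed (simp add: a fun_applies)
  qed
  have "a \<rho> = 1" if \<rho>: "\<rho> \<in> ?P" for \<rho>
  proof -
    have "zonal_component \<rho> (mat 1) = tk.ip t ?K (zonal_component \<rho>)"
      by (rule tk.ip_kernel[OF one_in_sym_mats zV[OF \<rho>], symmetric])
    also have "\<dots> = tk.ip t (zonal_component \<rho>) ?K" by (rule tk.ip_commute[OF K zV[OF \<rho>]])
    also have "\<dots> = (\<Sum>\<pi>\<in>?P. a \<pi> * (if \<pi> = \<rho> then zonal_component \<rho> (mat 1) else 0))"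
      unfolding K_eq tk.ip_sum_right tk.ip_scale_right
      by (intro sum.cong refl) (simp add: ip_zonal_components[OF _ \<rho>])
    also have "\<dots> = a \<rho> * zonal_component \<rho> (mat 1)"
      using \<rho> finP by (simp add: if_distrib[of "\<lambda>z. _ * z"] cong: if_cong)
    finally show ?thesis using zonal_component_one_pos[of \<rho>] by simp
  qed
  then show ?thesis unfolding K_eq by (intro sum.cong refl) (simp add: fun_eq_iff fun_applies)
qed

text \<open>
  In any decomposition of the trace power, the component for \<open>\<pi>\<close> pairs with the elements of its
  constituent as the whole power does, that is, by evaluation at the identity; hence uniqueness.
\<close>

lemma zonal_poly_eq:
  fixes \<pi> :: "'n::{finite,linorder} \<Rightarrow> nat"
  assumes "antimono \<pi>"
  shows "zonal_poly \<pi> = zonal_component \<pi>"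
proof -
  define t where "t = (\<Sum>i\<in>UNIV. \<pi> i)"
  let ?P = "partitions_upto t :: ('n \<Rightarrow> nat) set"
  let ?K = "pow_kernel t (mat 1) :: real^'n::_^'n::_ \<Rightarrow> real"
  have \<pi>P: "\<pi> \<in> ?P" using assms by (simp add: partitions_upto_def t_def)
  have zs: "zonal_space \<rho> = constituent \<rho>" if "\<rho> \<in> ?P" for \<rho>
    using that by (intro zonal_space_eq) (simp add: partitions_upto_def)
  have cV: "constituent \<rho> \<subseteq> hom_polys t" if "\<rho> \<in> ?P" for \<rho>
    using that constituent_subset[of \<rho>] by (simp add: partitions_upto_def)
  show ?thesis
    unfolding zonal_poly_def t_def[symmetric]
  proof (rule the_equality)
    have "trace X ^ t = (\<Sum>\<rho>\<in>?P. zonal_component \<rho> X)" if "X \<in> sym_mats" for X :: "real^'n::_^'n::_"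
      using fun_cong[OF pow_kernel_one_eq_sum[where 'n = 'n, of t], of X] that
      by (simp add: trace_power_eq_pow_kernel fun_applies)
    moreover have "zonal_component \<rho> \<in> zonal_space \<rho>" if "\<rho> \<in> ?P" for \<rho>
      using that zs[OF that] zonal_component(1)[of \<rho> t] by (simp add: partitions_upto_def)
    ultimately show "\<exists>C. C \<pi> = zonal_component \<pi> \<and> (\<forall>\<rho>\<in>?P. C \<rho> \<in> zonal_space \<rho>) \<and>
        (\<forall>X\<in>sym_mats. trace X ^ t = (\<Sum>\<rho>\<in>?P. C \<rho> X))"
      by (intro exI[of _ zonal_component]) blast
  next
    fix c assume "\<exists>C. C \<pi> = c \<and> (\<forall>\<rho>\<in>?P. C \<rho> \<in> zonal_space \<rho>) \<and>
        (\<forall>X\<in>sym_mats. trace X ^ t = (\<Sum>\<rho>\<in>?P. C \<rho> X))"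
    then obtain C where C: "C \<pi> = c" "\<And>\<rho>. \<rho> \<in> ?P \<Longrightarrow> C \<rho> \<in> constituent \<rho>"
      "\<And>X. X \<in> sym_mats \<Longrightarrow> trace X ^ t = (\<Sum>\<rho>\<in>?P. C \<rho> X)"
      using zs by auto
    have CV: "C \<rho> \<in> hom_polys t" if "\<rho> \<in> ?P" for \<rho> using C(2) cV that by blast
    have K: "?K \<in> hom_polys t" by (rule tk.k_in_V[OF one_in_sym_mats])
    have K_eq: "?K = (\<Sum>\<rho>\<in>?P. C \<rho>)"
    proof
      fix X show "?K X = (\<Sum>\<rho>\<in>?P. C \<rho>) X"
      proof (cases "X \<in> sym_mats")
        case True
        then show ?thesis by (simp add: trace_power_eq_pow_kernel C(3) fun_applies)
      next
        case False
        then show ?thesis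
          using tk.V_off[OF K False] tk.V_off[OF CV False] by (simp add: fun_applies)
      qed
    qed
    note z = zonal_component[of \<pi> t, OF t_def[symmetric]]
    let ?e = "C \<pi> - zonal_component \<pi>"
    have e: "?e \<in> constituent \<pi>"
      by (rule fs.subspace_diff[OF subspace_constituent C(2)[OF \<pi>P] z(1)])
    then have eV: "?e \<in> hom_polys t" using cV[OF \<pi>P] by blast
    have "?e (mat 1) = tk.ip t ?K ?e"
      by (rule tk.ip_kernel[OF one_in_sym_mats eV, symmetric])
    also have "\<dots> = (\<Sum>\<rho>\<in>?P. tk.ip t (C \<rho>) ?e)"
      unfolding K_eq by (rule tk.ip_sum_left[OF CV eV])
    also have "\<dots> = (\<Sum>\<rho>\<in>?P. if \<rho> = \<pi> then tk.ip t (C \<pi>) ?e else 0)"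
    proof (intro sum.cong refl)
      fix \<rho> assume \<rho>: "\<rho> \<in> ?P"
      show "tk.ip t (C \<rho>) ?e = (if \<rho> = \<pi> then tk.ip t (C \<pi>) ?e else 0)"
        using ip_constituent_constituent[of \<rho> t \<pi>, OF _ _ _ _ _ C(2)[OF \<rho>] e] \<rho> \<pi>P
        by (auto simp: partitions_upto_def)
    qed
    also have "\<dots> = tk.ip t (C \<pi>) ?e"
      using \<pi>P finite_partitions_upto[where 'n = 'n, of t] by simp
    finally have "tk.ip t (C \<pi>) ?e = tk.ip t (zonal_component \<pi>) ?e"
      using z(3)[OF e] by simp
    then have "tk.ip t ?e ?e = 0"
      by (subst tk.ip_diff_left[OF CV[OF \<pi>P] z(2) eV]) simp
    then have "?e = 0" by (rule tk.ip_eq_0[OF eV])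
    then show "c = zonal_component \<pi>" using C(1) by simp
  qed
qed

section \<open>Moments\<close>

lemma continuous_on_congruence: "continuous_on UNIV (\<lambda>Q :: real^'n^'n. Q ** D ** transpose Q)"
proof -
  interpret mm: bounded_bilinear "(**) :: real^'n^'n \<Rightarrow> real^'n^'n \<Rightarrow> real^'n^'n"
    by (rule bounded_bilinear_matrix_mult)
  show ?thesis
    by (intro mm.continuous_on continuous_intros linear_continuous_on bounded_linear_transpose)
qed

lemma continuous_on_orbit_power:
  "continuous_on UNIV (\<lambda>Q :: real^'n^'n. ((Q ** D ** transpose Q) \<bullet> X) ^ t)"
  by (intro continuous_intros continuous_on_congruence)

lemma bounded_orbit_mats: "bounded (orbit_mats lam)"
proof -
  have "orbit_mats lam = (\<lambda>Q. Q ** diag_mat lam ** transpose Q) ` {Q. orthogonal_matrix Q}"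
    by (auto simp: orbit_mats_def)
  then have "compact (orbit_mats lam)"
    by (simp, intro compact_continuous_image compact_orthogonal
        continuous_on_subset[OF continuous_on_congruence]) auto
  then show ?thesis by (rule compact_imp_bounded)
qed

lemma integrable_trace_inner_power:
  assumes "prob_space M" "P \<in> borel_measurable M" "\<And>\<omega>. \<omega> \<in> space M \<Longrightarrow> P \<omega> \<in> orbit_mats lam"
  shows "integrable M (\<lambda>\<omega>. trace_inner (P \<omega>) Y ^ t)"
proof -
  interpret prob_space M by fact
  obtain B where B: "\<And>Z. Z \<in> orbit_mats lam \<Longrightarrow> norm Z \<le> B"
    using bounded_orbit_mats[of lam] unfolding bounded_iff by blast
  have "norm (trace_inner (P \<omega>) Y ^ t) \<le> (B * norm Y) ^ t" if "\<omega> \<in> space M" for \<omega>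
  proof -
    have "\<bar>P \<omega> \<bullet> Y\<bar> \<le> norm (P \<omega>) * norm Y" by (rule Cauchy_Schwarz_ineq2)
    also have "\<dots> \<le> B * norm Y" by (intro mult_right_mono B assms(3) that) simp
    finally show ?thesis by (simp add: trace_inner_eq_inner power_abs power_mono)
  qed
  then have "AE \<omega> in M. norm (trace_inner (P \<omega>) Y ^ t) \<le> (B * norm Y) ^ t"
    by (rule AE_I2)
  moreover have "(\<lambda>\<omega>. trace_inner (P \<omega>) Y ^ t) \<in> borel_measurable M"
    unfolding trace_inner_eq_inner
    by (intro borel_measurable_power borel_measurable_inner borel_measurable_const assms(2))
  ultimately show ?thesis by (rule integrable_const_bound)
qed

lemma cross_moment_polarization:
  assumes M: "prob_space M" "P \<in> borel_measurable M" "\<And>\<omega>. \<omega> \<in> space M \<Longrightarrow> P \<omega> \<in> orbit_mats lam"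
  shows "cross_moment M P t X =
    1 / fact t * (\<Sum>J\<in>Pow {1..t}. (-1) ^ (t + card J) * trace_moment M P t (\<Sum>j\<in>J. X j))"
proof -
  have eq: "(\<Prod>j=1..t. trace_inner (X j) (P \<omega>)) =
      1 / fact t * (\<Sum>J\<in>Pow {1..t}. (-1) ^ (t + card J) * trace_inner (P \<omega>) (\<Sum>j\<in>J. X j) ^ t)" for \<omega>
    using polarization[of "{1..t}" "\<lambda>j. trace_inner (X j) (P \<omega>)"]
    by (simp add: trace_inner_eq_inner inner_sum_right inner_commute)
  show ?thesis
    unfolding cross_moment_def trace_moment_def eq
    by (simp add: integrable_trace_inner_power[OF M])
qed

lemma trace_moment_eq_orbit_moment:
  assumes "P \<in> borel_measurable M" "distr M borel P = orbit_distr H lam"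
  shows "trace_moment M P t Y = orbit_moment H lam t Y"
proof -
  have "(\<integral>Z. trace_inner Z Y ^ t \<partial>distr M borel P) = (\<integral>\<omega>. trace_inner (P \<omega>) Y ^ t \<partial>M)"
    by (rule integral_distr) (use assms(1) in \<open>auto simp: trace_inner_eq_inner\<close>)
  then show ?thesis by (simp add: trace_moment_def orbit_moment_def assms(2))
qed

context
  fixes H :: "(real^'n^'n) measure"
  assumes H: "normalized_haar H"
begin

lemma haar_sets: "sets H = sets (restrict_space borel {Q. orthogonal_matrix Q})"
  using H by (simp add: normalized_haar_def)

lemma haar_space: "space H = {Q. orthogonal_matrix Q}"
  using sets_eq_imp_space_eq[OF haar_sets] by (simp add: space_restrict_space)

lemma haar_prob_space: "prob_space H"
  using H by (simp add: normalized_haar_def)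

lemma haar_measurable:
  assumes "continuous_on UNIV f"
  shows "f \<in> borel_measurable H"
proof -
  have "f \<in> borel_measurable borel" by (rule borel_measurable_continuous_onI[OF assms])
  then have "f \<in> borel_measurable (restrict_space borel {Q. orthogonal_matrix Q})"
    by (rule measurable_restrict_space1)
  then show ?thesis by (simp only: measurable_cong_sets[OF haar_sets refl])
qed

lemma haar_integrable:
  fixes f :: "real^'n^'n \<Rightarrow> real"
  assumes "continuous_on UNIV f"
  shows "integrable H f"
proof -
  interpret prob_space H by (rule haar_prob_space)
  have "compact (f ` {Q. orthogonal_matrix Q})"
    by (intro compact_continuous_image compact_orthogonal continuous_on_subset[OF assms]) simp
  then have "bounded (f ` {Q. orthogonal_matrix Q})" by (rule compact_imp_bounded)
  then obtain B where "\<forall>x\<in>f ` {Q. orthogonal_matrix Q}. norm x \<le> B"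
    unfolding bounded_iff by blast
  then have "norm (f Q) \<le> B" if "orthogonal_matrix Q" for Q
    using that by blast
  then have "AE Q in H. norm (f Q) \<le> B" by (intro AE_I2) (simp add: haar_space)
  then show ?thesis using haar_measurable[OF assms] by (rule integrable_const_bound)
qed

lemma haar_integral_translate:
  fixes f :: "real^'n^'n \<Rightarrow> real"
  assumes "continuous_on UNIV f" and Q: "orthogonal_matrix Q"
  shows "(\<integral>R. f (Q ** R) \<partial>H) = (\<integral>R. f R \<partial>H)"
proof -
  interpret mm: bounded_bilinear "(**) :: real^'n^'n \<Rightarrow> real^'n^'n \<Rightarrow> real^'n^'n"
    by (rule bounded_bilinear_matrix_mult)
  have "continuous_on UNIV (\<lambda>R :: real^'n^'n. Q ** R)"
    by (rule mm.continuous_on[OF continuous_on_const continuous_on_id])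
  then have "(\<lambda>R. Q ** R) \<in> borel_measurable H" by (rule haar_measurable)
  then have "(\<lambda>R. Q ** R) \<in> measurable H (restrict_space borel {Q. orthogonal_matrix Q})"
    using Q by (intro measurable_restrict_space2) (auto simp: haar_space orthogonal_matrix_mul)
  then have m: "(\<lambda>R. Q ** R) \<in> measurable H H"
    by (simp only: measurable_cong_sets[OF refl haar_sets])
  have "(\<integral>R. f R \<partial>H) = (\<integral>R. f R \<partial>distr H H (\<lambda>R. Q ** R))"
    using H Q by (simp add: normalized_haar_def)
  also have "\<dots> = (\<integral>R. f (Q ** R) \<partial>H)"
    by (rule integral_distr[OF m haar_measurable[OF assms(1)]])
  finally show ?thesis by simp
qed

lemma orbit_moment_eq:
  "orbit_moment H lam t X = (\<integral>Q. ((Q ** diag_mat lam ** transpose Q) \<bullet> X) ^ t \<partial>H)"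
  unfolding orbit_moment_def orbit_distr_def trace_inner_eq_inner
  by (rule integral_distr) (auto intro: haar_measurable continuous_on_congruence)

text \<open>
  A conjugation of the argument is a left translation of the integration variable.
\<close>

lemma conj_invariant_orbit_moment: "conj_invariant (orbit_moment H lam t)"
  unfolding conj_invariant_def
proof (intro allI impI)
  fix Q X :: "real^'n^'n" assume Q: "orthogonal_matrix Q"
  let ?D = "diag_mat lam"
  have "(R ** ?D ** transpose R) \<bullet> (transpose Q ** X ** Q) =
      ((Q ** R) ** ?D ** transpose (Q ** R)) \<bullet> X" for R
    by (simp add: inner_congruence matrix_transpose_mul matrix_mul_assoc)
  then show "orbit_moment H lam t (transpose Q ** X ** Q) = orbit_moment H lam t X"
    unfolding orbit_moment_eq
    by (simp add: haar_integral_translate[OF continuous_on_orbit_power[of ?D X t] Q])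
qed

lemma orbit_moment_diag_mat:
  "(\<lambda>x. orbit_moment H lam t (diag_mat x)) \<in> fs.span (word_monom ` words t)"
proof -
  define a :: "real^'n^'n \<Rightarrow> real^'n" where
    "a = (\<lambda>Q. \<chi> i. (Q ** diag_mat lam ** transpose Q) $ i $ i)"
  have "continuous_on UNIV (\<lambda>Q. a Q $ i)" for i
    unfolding a_def vec_lambda_beta
    by (rule continuous_on_component[OF continuous_on_component[OF continuous_on_congruence]])
  then have "continuous_on UNIV (\<lambda>Q. word_monom l (a Q))" for l
    unfolding word_monom_eq_prod_power by (rule continuous_on_prod[OF continuous_on_power])
  then have int: "integrable H (\<lambda>Q. word_monom l (a Q))" for l by (rule haar_integrable)
  have pw: "((Q ** diag_mat lam ** transpose Q) \<bullet> diag_mat x) ^ t =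
      (\<Sum>l\<in>words t. word_monom l (a Q) * word_monom l x)" for Q x
    unfolding inner_diag_mat a_def by (rule power_sum_words)
  have eq: "(\<lambda>x. orbit_moment H lam t (diag_mat x)) =
      (\<Sum>l\<in>words t. fscale (\<integral>Q. word_monom l (a Q) \<partial>H) (word_monom l))"
  proof
    fix x
    have "orbit_moment H lam t (diag_mat x) =
        (\<Sum>l\<in>words t. (\<integral>Q. word_monom l (a Q) \<partial>H) * word_monom l x)"
      unfolding orbit_moment_eq pw
      by (subst Bochner_Integration.integral_sum) (auto simp: int)
    then show "orbit_moment H lam t (diag_mat x) =
        (\<Sum>l\<in>words t. fscale (\<integral>Q. word_monom l (a Q) \<partial>H) (word_monom l)) x"
      by (simp only: fun_applies)
  qed
  show ?thesis
    unfolding eq by (intro fs.span_sum fs.span_scale) (auto intro: fs.span_base)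
qed

end

text \<open>
  The coefficients of the orbit moment in terms of the zonal components are found by pairing with a
  component.  That pairing is a finite combination of evaluations, so it commutes with the integral,
  and under the integral it gives the value of the component at a point of the orbit, which
  is constant.
\<close>

lemma orbit_moment_expansion:
  fixes H :: "(real^'n::{finite,linorder}^'n::_) measure"
  assumes H: "normalized_haar H" and Y: "Y \<in> sym_mats"
  shows "orbit_moment H lam t Y = (\<Sum>\<pi>\<in>partitions_upto t.
    zonal_component \<pi> Y * zonal_component \<pi> (diag_mat lam) / zonal_component \<pi> (mat 1))"
proof -
  interpret prob_space H by (rule haar_prob_space[OF H])
  let ?P = "partitions_upto t :: ('n \<Rightarrow> nat) set"
  let ?q = "\<lambda>Q :: real^'n::_^'n::_. Q ** diag_mat lam ** transpose Q"
  note finP = finite_partitions_upto[where 'n = 'n, of t]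
  obtain a where a: "\<And>X. X \<in> sym_mats \<Longrightarrow>
      orbit_moment H lam t X = (\<Sum>\<pi>\<in>?P. a \<pi> * zonal_component \<pi> X)"
    using conj_invariant_in_span[OF conj_invariant_orbit_moment[OF H] orbit_moment_diag_mat[OF H]]
    by blast
  have "a \<rho> * zonal_component \<rho> (mat 1) = zonal_component \<rho> (diag_mat lam)" if \<rho>: "\<rho> \<in> ?P" for \<rho>
  proof -
    let ?z = "zonal_component \<rho>"
    let ?R = "fst (tk.rep t ?z)" and ?c = "snd (tk.rep t ?z)"
    have zV: "?z \<in> hom_polys t"
      using \<rho> zonal_component(2)[of \<rho> t] by (simp add: partitions_upto_def)
    note rep = tk.rep[OF zV]
    have inv: "?z (?q Q) = ?z (diag_mat lam)" if "orthogonal_matrix Q" for Q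
    proof -
      have "orthogonal_matrix (transpose Q)" using that by simp
      then have "?z (transpose (transpose Q) ** diag_mat lam ** transpose Q) = ?z (diag_mat lam)"
        using conj_invariant_zonal_component[of \<rho>] diag_mat_in_sym_mats
        unfolding conj_invariant_def by blast
      then show ?thesis by simp
    qed
    have "(\<Sum>X\<in>?R. ?c X * orbit_moment H lam t X) =
        (\<Sum>X\<in>?R. \<Sum>\<pi>\<in>?P. ?c X * (a \<pi> * zonal_component \<pi> X))"
      using rep(2) by (intro sum.cong refl) (auto simp: a subset_iff sum_distrib_left)
    also have "\<dots> = (\<Sum>\<pi>\<in>?P. \<Sum>X\<in>?R. ?c X * (a \<pi> * zonal_component \<pi> X))"
      by (rule sum.swap)
    also have "\<dots> = (\<Sum>\<pi>\<in>?P. a \<pi> * tk.ip t ?z (zonal_component \<pi>))"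
      by (simp add: tk.ip_def sum_distrib_left mult_ac)
    also have "\<dots> = (\<Sum>\<pi>\<in>?P. a \<pi> * (if \<pi> = \<rho> then ?z (mat 1) else 0))"
      by (intro sum.cong refl) (simp add: ip_zonal_components[OF _ \<rho>])
    also have "\<dots> = a \<rho> * ?z (mat 1)"
      using \<rho> finP by (simp add: if_distrib[of "\<lambda>z. _ * z"] cong: if_cong)
    finally have 1: "(\<Sum>X\<in>?R. ?c X * orbit_moment H lam t X) = a \<rho> * ?z (mat 1)" .
    have z_eq: "?z Z = (\<Sum>X\<in>?R. ?c X * (Z \<bullet> X) ^ t)" if "Z \<in> sym_mats" for Z
      using fun_cong[OF rep(3), of Z] that by (simp add: fun_applies pow_kernel_def inner_commute)
    have "(\<Sum>X\<in>?R. ?c X * orbit_moment H lam t X) =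
        (\<integral>Q. (\<Sum>X\<in>?R. ?c X * (?q Q \<bullet> X) ^ t) \<partial>H)"
      unfolding orbit_moment_eq[OF H]
      by (subst Bochner_Integration.integral_sum)
        (auto intro: haar_integrable[OF H continuous_on_orbit_power])
    also have "\<dots> = (\<integral>Q. ?z (diag_mat lam) \<partial>H)"
    proof (rule Bochner_Integration.integral_cong[OF refl])
      fix Q assume "Q \<in> space H"
      then have Q: "orthogonal_matrix Q" by (simp add: haar_space[OF H])
      show "(\<Sum>X\<in>?R. ?c X * (?q Q \<bullet> X) ^ t) = ?z (diag_mat lam)"
        using z_eq[OF sym_congruence'[OF diag_mat_in_sym_mats[of lam], of Q]] inv[OF Q] by simp
    qed
    also have "\<dots> = ?z (diag_mat lam)" by (simp add: prob_space)
    finally show ?thesis using 1 by simp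
  qed
  then have "a \<rho> = zonal_component \<rho> (diag_mat lam) / zonal_component \<rho> (mat 1)" if "\<rho> \<in> ?P" for \<rho>
    using that zonal_component_one_pos[of \<rho>] by (simp add: field_simps)
  then show ?thesis
    unfolding a[OF Y] by (intro sum.cong refl) (simp add: mult.commute)
qed

theorem theorem7p2:
  fixes lam :: "real^'n::{finite,linorder}"
    and k t :: nat
    and M :: "'a measure"
    and P :: "'a \<Rightarrow> real^'n::_^'n::_"
    and X :: "nat \<Rightarrow> real^'n::_^'n::_"
    and H :: "(real^'n::_^'n::_) measure"
  assumes k: "1 \<le> k" "k < CARD('n)"
    and lam_le1: "\<And>i. lam $ i \<le> 1"
    and lam_antimono: "\<And>i j. i \<le> j \<Longrightarrow> lam $ j \<le> lam $ i"
    and lam_pos: "\<And>i. card {j. j < i} < k \<Longrightarrow> 0 < lam $ i"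
    and lam_zero: "\<And>i. k \<le> card {j. j < i} \<Longrightarrow> lam $ i = 0"
    and t: "1 \<le> t"
    and M: "prob_space M"
    and P_meas: "P \<in> borel_measurable M"
    and P_vals: "\<And>\<omega>. \<omega> \<in> space M \<Longrightarrow> P \<omega> \<in> orbit_mats lam"
    and X: "\<And>j. j \<in> {1..t} \<Longrightarrow> X j \<in> sym_mats"
    and H: "normalized_haar H"
  shows "cross_moment M P t X =
           1 / fact t * (\<Sum>J\<in>Pow {1..t}. (-1) ^ (t + card J) * trace_moment M P t (\<Sum>j\<in>J. X j))
       \<and> (distr M borel P = orbit_distr H lam \<longrightarrow>
           (\<forall>Y\<in>sym_mats. trace_moment M P t Y = orbit_moment H lam t Y))
       \<and> (\<forall>Y\<in>sym_mats. orbit_moment H lam t Y =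
           (\<Sum>\<pi>\<in>partitions_upto t.
              zonal_poly \<pi> Y * zonal_poly \<pi> (diag_mat lam) / zonal_poly \<pi> (mat 1)))"
proof (intro conjI impI ballI)
  show "cross_moment M P t X =
      1 / fact t * (\<Sum>J\<in>Pow {1..t}. (-1) ^ (t + card J) * trace_moment M P t (\<Sum>j\<in>J. X j))"
    by (rule cross_moment_polarization[OF M P_meas P_vals])
  show "trace_moment M P t Y = orbit_moment H lam t Y"
    if "distr M borel P = orbit_distr H lam" for Y
    by (rule trace_moment_eq_orbit_moment[OF P_meas that])
  show "orbit_moment H lam t Y = (\<Sum>\<pi>\<in>partitions_upto t.
      zonal_poly \<pi> Y * zonal_poly \<pi> (diag_mat lam) / zonal_poly \<pi> (mat 1))" if "Y \<in> sym_mats" for Y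
    unfolding orbit_moment_expansion[OF H that]
    by (intro sum.cong refl) (simp add: zonal_poly_eq partitions_upto_def)
qed

end
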